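(* For every $n\geq 4$ there exist a closed Riemannian $n$-manifold $(M,g)$ and infinitely many isoparametric foliations $\mathcal F_i$ on $(M,g)$ such that, for each fixed $i$, all leaves of $\mathcal F_i$ are diffeomorphic to each other, while for $i\neq j$ the leaves of $\mathcal F_i$ are not homeomorphic to the leaves of $\mathcal F_j$.
   Context: An isoparametric function on a complete Riemannian manifold $(M,g)$ is a nonconstant smooth function $f\colon M\to\mathbb R$ satisfying $\|\nabla f\|^2=b(f)$ and $\Delta f=a(f)$ for some smooth function $b\colon f(M)\to\mathbb R$ and some continuous function $a\colon f(M)\to\mathbb R$. An isoparametric foliation on $(M,g)$ is the partition of $M$ into the connected components (called leaves, which are smooth submanifolds) of the level sets of an isoparametric function on $(M,g)$. *)

theory Defs
  imports "HOL-Analysis.Analysis"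
begin

section \<open>Smooth maps between open subsets of normed spaces\<close>

text \<open>
  The following two notions are only meant for open \<open>S\<close> in a finite-dimensional domain, where
  they say that all iterated directional derivatives exist up to the given order and are
  continuous.
\<close>

primrec Ck_on :: "nat \<Rightarrow> 'a::real_normed_vector set \<Rightarrow> ('a \<Rightarrow> 'b::real_normed_vector) \<Rightarrow> bool" where
  "Ck_on 0 S f \<longleftrightarrow> continuous_on S f"
| "Ck_on (Suc k) S f \<longleftrightarrow>
     (\<forall>x\<in>S. f differentiable (at x)) \<and> (\<forall>v. Ck_on k S (\<lambda>x. frechet_derivative f (at x) v))"

definition smooth_on :: "'a::real_normed_vector set \<Rightarrow> ('a \<Rightarrow> 'b::real_normed_vector) \<Rightarrow> bool" where
  "smooth_on S f \<longleftrightarrow> (\<forall>k. Ck_on k S f)"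

definition partial_deriv :: "'n::finite \<Rightarrow> (real^'n \<Rightarrow> real) \<Rightarrow> real^'n \<Rightarrow> real" where
  "partial_deriv i u x = frechet_derivative u (at x) (axis i 1)"


section \<open>Smooth manifolds\<close>

text \<open>
  A chart is a pair \<open>(U, \<phi>)\<close> of a domain and a coordinate map; the values of \<open>\<phi>\<close> outside \<open>U\<close> are
  irrelevant. The inverse of the chart is \<open>inv_into U \<phi>\<close>.
\<close>

type_synonym ('a, 'n) chart = "'a set \<times> ('a \<Rightarrow> real^'n)"

definition is_chart :: "'a topology \<Rightarrow> ('a, 'n::finite) chart \<Rightarrow> bool" where
  "is_chart X = (\<lambda>(U, \<phi>). openin X U \<and> open (\<phi> ` U) \<and>
     homeomorphic_map (subtopology X U) (top_of_set (\<phi> ` U)) \<phi>)"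

definition compatible_charts :: "('a, 'n::finite) chart \<Rightarrow> ('a, 'n) chart \<Rightarrow> bool" where
  "compatible_charts = (\<lambda>(U, \<phi>) (V, \<psi>).
     smooth_on (\<phi> ` (U \<inter> V)) (\<psi> \<circ> inv_into U \<phi>) \<and>
     smooth_on (\<psi> ` (U \<inter> V)) (\<phi> \<circ> inv_into V \<psi>))"

text \<open>
  The atlas \<open>A\<close> need not be maximal. The manifold has no boundary, since charts have open images
  in \<open>real^'n\<close>; its dimension is \<open>CARD('n)\<close>.
\<close>

definition smooth_manifold :: "'a topology \<Rightarrow> ('a, 'n::finite) chart set \<Rightarrow> bool" where
  "smooth_manifold X A \<longleftrightarrow>
     Hausdorff_space X \<and>
     (\<exists>\<B>. countable \<B> \<and> (\<forall>B\<in>\<B>. openin X B) \<and>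
        (\<forall>U x. openin X U \<and> x \<in> U \<longrightarrow> (\<exists>B\<in>\<B>. x \<in> B \<and> B \<subseteq> U))) \<and>
     (\<forall>c\<in>A. is_chart X c) \<and>
     \<Union> (fst ` A) = topspace X \<and>
     (\<forall>c\<in>A. \<forall>d\<in>A. compatible_charts c d)"

definition smooth_function :: "('a, 'n::finite) chart set \<Rightarrow> ('a \<Rightarrow> real) \<Rightarrow> bool" where
  "smooth_function A f \<longleftrightarrow> (\<forall>(U, \<phi>)\<in>A. smooth_on (\<phi> ` U) (f \<circ> inv_into U \<phi>))"

definition smooth_map_on_open ::
    "'a topology \<Rightarrow> ('a, 'n::finite) chart set \<Rightarrow> 'a set \<Rightarrow> ('a \<Rightarrow> 'a) \<Rightarrow> bool" where
  "smooth_map_on_open X A W h \<longleftrightarrow>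
     openin X W \<and> continuous_map (subtopology X W) X h \<and>
     (\<forall>(U, \<phi>)\<in>A. \<forall>(V, \<psi>)\<in>A.
        smooth_on (\<phi> ` {q \<in> U \<inter> W. h q \<in> V}) (\<psi> \<circ> h \<circ> inv_into U \<phi>))"


section \<open>Embedded submanifolds and their diffeomorphisms\<close>

text \<open>
  The slice charts may be any charts of the smooth structure generated by \<open>A\<close>.
\<close>

definition embedded_submanifold ::
    "nat \<Rightarrow> 'a topology \<Rightarrow> ('a, 'n::finite) chart set \<Rightarrow> 'a set \<Rightarrow> bool" where
  "embedded_submanifold k X A S \<longleftrightarrow>
     S \<subseteq> topspace X \<and>
     (\<forall>p\<in>S. \<exists>U \<phi> V. is_chart X (U, \<phi>) \<and> (\<forall>c\<in>A. compatible_charts c (U, \<phi>)) \<and> p \<in> U \<and>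
        subspace V \<and> dim V = k \<and> \<phi> ` (U \<inter> S) = \<phi> ` U \<inter> V)"

text \<open>
  A map between embedded submanifolds is smooth for the induced smooth structures if and only if
  near each point it is the restriction of a smooth map defined on an open subset of the
  ambient manifold.
\<close>

definition smooth_map_between ::
    "'a topology \<Rightarrow> ('a, 'n::finite) chart set \<Rightarrow> 'a set \<Rightarrow> 'a set \<Rightarrow> ('a \<Rightarrow> 'a) \<Rightarrow> bool" where
  "smooth_map_between X A S T h \<longleftrightarrow>
     h ` S \<subseteq> T \<and>
     (\<forall>p\<in>S. \<exists>W H. p \<in> W \<and> smooth_map_on_open X A W H \<and> (\<forall>q\<in>S \<inter> W. H q = h q))"

definition diffeomorphic_submanifolds ::
    "'a topology \<Rightarrow> ('a, 'n::finite) chart set \<Rightarrow> 'a set \<Rightarrow> 'a set \<Rightarrow> bool" where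
  "diffeomorphic_submanifolds X A S T \<longleftrightarrow>
     (\<exists>k. embedded_submanifold k X A S) \<and> (\<exists>k. embedded_submanifold k X A T) \<and>
     (\<exists>h. bij_betw h S T \<and> smooth_map_between X A S T h \<and>
          smooth_map_between X A T S (inv_into S h))"


section \<open>Riemannian metrics, gradient and Laplacian\<close>

text \<open>
  A metric is given by its Gram matrices in the charts of \<open>A\<close>: \<open>g (U, \<phi>) x\<close> is the matrix of
  \<open>g\<^sub>i\<^sub>j\<close> at the point with coordinates \<open>x \<in> \<phi> ` U\<close>. The last clause is the transformation law of
  a covariant 2-tensor, \<open>J\<close> being the Jacobian of the coordinate change.
\<close>

type_synonym ('a, 'n) metric = "('a, 'n) chart \<Rightarrow> real^'n \<Rightarrow> real^'n^'n"

definition riemannian_metric :: "('a, 'n::finite) chart set \<Rightarrow> ('a, 'n) metric \<Rightarrow> bool" where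
  "riemannian_metric A g \<longleftrightarrow>
     (\<forall>(U, \<phi>)\<in>A. smooth_on (\<phi> ` U) (g (U, \<phi>)) \<and>
        (\<forall>x\<in>\<phi> ` U. transpose (g (U, \<phi>) x) = g (U, \<phi>) x \<and>
                   (\<forall>v. v \<noteq> 0 \<longrightarrow> v \<bullet> (g (U, \<phi>) x *v v) > 0))) \<and>
     (\<forall>(U, \<phi>)\<in>A. \<forall>(V, \<psi>)\<in>A. \<forall>p\<in>U \<inter> V.
        let J = matrix (frechet_derivative (\<psi> \<circ> inv_into U \<phi>) (at (\<phi> p)))
        in g (U, \<phi>) (\<phi> p) = transpose J ** g (V, \<psi>) (\<psi> p) ** J)"

text \<open>
  A closed manifold is a compact one without boundary. Manifolds are taken to be connected.
\<close>

definition closed_riemannian_manifold ::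
    "'a topology \<Rightarrow> ('a, 'n::finite) chart set \<Rightarrow> ('a, 'n) metric \<Rightarrow> bool" where
  "closed_riemannian_manifold X A g \<longleftrightarrow>
     smooth_manifold X A \<and> riemannian_metric A g \<and>
     compact_space X \<and> connected_space X \<and> topspace X \<noteq> {}"

text \<open>
  The next three functions are the usual local expressions in a coordinate domain with Gram
  matrix \<open>G\<close>: \<open>(grad u)\<^sup>i = g\<^sup>i\<^sup>j \<partial>\<^sub>j u\<close> and \<open>div Y = (det G) powr (-1/2) * \<partial>\<^sub>i (sqrt (det G) * Y\<^sup>i)\<close>,
  summed over repeated indices.
\<close>

definition local_grad :: "(real^'n \<Rightarrow> real^'n^'n) \<Rightarrow> (real^'n \<Rightarrow> real) \<Rightarrow> real^'n::finite \<Rightarrow> real^'n" where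
  "local_grad G u x = matrix_inv (G x) *v (\<chi> j. partial_deriv j u x)"

definition local_div :: "(real^'n \<Rightarrow> real^'n^'n) \<Rightarrow> (real^'n \<Rightarrow> real^'n) \<Rightarrow> real^'n::finite \<Rightarrow> real" where
  "local_div G Y x =
     (\<Sum>i\<in>UNIV. partial_deriv i (\<lambda>y. sqrt (det (G y)) * Y y $ i) x) / sqrt (det (G x))"

definition local_laplacian :: "(real^'n \<Rightarrow> real^'n^'n) \<Rightarrow> (real^'n \<Rightarrow> real) \<Rightarrow> real^'n::finite \<Rightarrow> real" where
  "local_laplacian G u = local_div G (local_grad G u)"

definition grad_norm_sq_in ::
    "('a, 'n::finite) metric \<Rightarrow> ('a, 'n) chart \<Rightarrow> ('a \<Rightarrow> real) \<Rightarrow> 'a \<Rightarrow> real" where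
  "grad_norm_sq_in g = (\<lambda>(U, \<phi>) f p.
     let v = local_grad (g (U, \<phi>)) (f \<circ> inv_into U \<phi>) (\<phi> p)
     in v \<bullet> (g (U, \<phi>) (\<phi> p) *v v))"

definition laplacian_in ::
    "('a, 'n::finite) metric \<Rightarrow> ('a, 'n) chart \<Rightarrow> ('a \<Rightarrow> real) \<Rightarrow> 'a \<Rightarrow> real" where
  "laplacian_in g = (\<lambda>(U, \<phi>) f p. local_laplacian (g (U, \<phi>)) (f \<circ> inv_into U \<phi>) (\<phi> p))"


section \<open>Isoparametric functions and foliations\<close>

text \<open>
  The norm of the gradient and the Laplacian do not depend on the chart in which they are
  computed; the two equations are required in every chart around every point.
  Smoothness of \<open>b\<close> on \<open>f(M)\<close>, which need not be open, means that \<open>b\<close> extends smoothly to an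
  open neighbourhood of \<open>f(M)\<close>. The definition is for complete \<open>(M, g)\<close>; it is used below only
  for compact, hence complete, manifolds.
\<close>

definition isoparametric_function ::
    "'a topology \<Rightarrow> ('a, 'n::finite) chart set \<Rightarrow> ('a, 'n) metric \<Rightarrow> ('a \<Rightarrow> real) \<Rightarrow> bool" where
  "isoparametric_function X A g f \<longleftrightarrow>
     smooth_function A f \<and>
     \<not> f constant_on topspace X \<and>
     (\<exists>b W. open W \<and> f ` topspace X \<subseteq> W \<and> smooth_on W b \<and>
        (\<forall>(U, \<phi>)\<in>A. \<forall>p\<in>U. grad_norm_sq_in g (U, \<phi>) f p = b (f p))) \<and>
     (\<exists>a. continuous_on (f ` topspace X) a \<and>
        (\<forall>(U, \<phi>)\<in>A. \<forall>p\<in>U. laplacian_in g (U, \<phi>) f p = a (f p)))"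

text \<open>
  A foliation is represented by its set of leaves.
\<close>

definition level_components :: "'a topology \<Rightarrow> ('a \<Rightarrow> real) \<Rightarrow> 'a set set" where
  "level_components X f =
     (\<Union>t\<in>f ` topspace X. connected_components_of (subtopology X {p \<in> topspace X. f p = t}))"

definition isoparametric_foliation ::
    "'a topology \<Rightarrow> ('a, 'n::finite) chart set \<Rightarrow> ('a, 'n) metric \<Rightarrow> 'a set set \<Rightarrow> bool" where
  "isoparametric_foliation X A g \<F> \<longleftrightarrow>
     (\<exists>f. isoparametric_function X A g f \<and> \<F> = level_components X f)"

text \<open>
  In the existence statement the points of the manifold are taken from the type \<open>(real^'n) set\<close>,
  with an arbitrary topology on an arbitrary carrier. The type is only a universe that is large
  enough: a manifold has at most the cardinality of the continuum, so its points can
  always be relabelled in this way (and quotients of \<open>real^'n\<close> live there directly).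
\<close>

end

theory Submission
  imports Defs
begin

text \<open>
  \<open>M\<close> is the product of the compact Heisenberg nilmanifold with a flat torus, i.e. the quotient of
  \<open>\<real>\<^sup>n\<close> (with the Heisenberg multiplication in the coordinates \<open>x, y, z\<close>) by its integer lattice,
  with the left invariant metric \<open>dx\<^sup>2 + dy\<^sup>2 + (dz - x dy)\<^sup>2 + \<dots>\<close>. The linear form \<open>y + k t\<close> is
  harmonic with gradient of constant length and is integral on the lattice, so
  \<open>cos (2 \<pi> (y + k t))\<close> is an isoparametric function. Its leaves are the images of the hyperplanes
  \<open>y + k t = s\<close>, and for \<open>k \<ge> 1\<close> they are permuted transitively by the isometric flow along \<open>t\<close>.
  A leaf is the quotient of a hyperplane by the lattice points with \<open>y + k t = 0\<close>. A homeomorphism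
  of leaves lifts to the hyperplanes and conjugates these groups into each other; all commutators
  of the group are \<open>d\<close>-th powers in it exactly if \<open>d\<close> divides \<open>k\<close>, so \<open>k\<close> is a topological invariant.
\<close>

section \<open>Smooth functions\<close>

lemma frechet_derivative_cong_open:
  fixes f g :: "'a::real_normed_vector \<Rightarrow> 'b::real_normed_vector"
  assumes "open S" "x \<in> S" "\<And>y. y \<in> S \<Longrightarrow> f y = g y"
  shows "frechet_derivative f (at x) = frechet_derivative g (at x)"
proof -
  have "(f has_derivative D) (at x) \<longleftrightarrow> (g has_derivative D) (at x)" for D
    using assms by (metis has_derivative_transform_within_open)
  then show ?thesis by (simp add: frechet_derivative_def)
qed

lemma Ck_on_cong:
  assumes "open S" "\<And>x. x \<in> S \<Longrightarrow> f x = g x"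
  shows "Ck_on k S f \<longleftrightarrow> Ck_on k S g"
  using assms(2)
proof (induction k arbitrary: f g)
  case 0
  then show ?case by (simp cong: continuous_on_cong)
next
  case (Suc k)
  have "f differentiable (at x) \<longleftrightarrow> g differentiable (at x)" if "x \<in> S" for x
    using that assms(1) Suc.prems
    unfolding differentiable_def by (metis has_derivative_transform_within_open)
  moreover have "Ck_on k S (\<lambda>x. frechet_derivative f (at x) v)
      \<longleftrightarrow> Ck_on k S (\<lambda>x. frechet_derivative g (at x) v)" for v
    using frechet_derivative_cong_open[OF assms(1) _ Suc.prems] by (intro Suc.IH) auto
  ultimately show ?case by simp
qed

lemma Ck_on_local:
  assumes "\<And>x. x \<in> S \<Longrightarrow> \<exists>U. open U \<and> x \<in> U \<and> Ck_on k U f"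
  shows "Ck_on k S f"
  using assms
proof (induction k arbitrary: f)
  case 0
  show ?case
    using 0 by (force intro: continuous_at_imp_continuous_on simp: continuous_on_eq_continuous_at)
next
  case (Suc k)
  have "Ck_on k S (\<lambda>x. frechet_derivative f (at x) v)" for v
  proof (rule Suc.IH)
    fix x assume "x \<in> S"
    from Suc.prems[OF this] show "\<exists>U. open U \<and> x \<in> U \<and> Ck_on k U (\<lambda>x. frechet_derivative f (at x) v)"
      by auto
  qed
  moreover have "f differentiable (at x)" if "x \<in> S" for x
    using Suc.prems[OF that] by auto
  ultimately show ?case by simp
qed

text \<open>Serves the coordinate changes below: near each point they agree with one left
  translation, but the lattice element depends on the point.\<close>

lemma smooth_on_cong_local:
  assumes "\<And>x. x \<in> S \<Longrightarrow> \<exists>U g. open U \<and> x \<in> U \<and> smooth_on U g \<and> (\<forall>y\<in>U. f y = g y)"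
  shows "smooth_on S f"
  unfolding smooth_on_def
proof (intro allI Ck_on_local)
  fix k x assume "x \<in> S"
  then obtain U g where "open U" "x \<in> U" "smooth_on U g" "\<And>y. y \<in> U \<Longrightarrow> f y = g y"
    using assms by metis
  then show "\<exists>U. open U \<and> x \<in> U \<and> Ck_on k U f"
    using Ck_on_cong[of U f g k] by (auto simp: smooth_on_def)
qed

section \<open>Smoothness from explicit derivatives: quadratic, trigonometric and affine
  maps\<close>

lemma Ck_on_SucI:
  assumes "\<And>x. x \<in> S \<Longrightarrow> (f has_derivative f' x) (at x)"
    and "open S" "\<And>v. Ck_on k S (\<lambda>x. f' x v)"
  shows "Ck_on (Suc k) S f"
proof -
  have eq: "f' x = frechet_derivative f (at x)" if "x \<in> S" for x
    using assms(1)[OF that] by (rule frechet_derivative_at)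
  have "Ck_on k S (\<lambda>x. frechet_derivative f (at x) v)" for v
    using assms(3)[of v] Ck_on_cong[OF assms(2), of "\<lambda>x. f' x v"] by (simp add: eq)
  then show ?thesis using assms(1) by (auto simp: differentiable_def)
qed

text \<open>Directional derivatives stay in the family, with new coefficients, so the induction runs
  over all \<open>M0\<close>, \<open>M1\<close>, \<open>M2\<close> at once. The derivative is
  written with a zero quadratic coefficient to keep this shape.\<close>

lemma smooth_on_quadratic:
  fixes M0 M1 M2 :: "'b::real_normed_vector"
  assumes l: "bounded_linear l" and "open S"
  shows "smooth_on S (\<lambda>v. M0 + l v *\<^sub>R M1 + (l v)\<^sup>2 *\<^sub>R M2)"
proof -
  interpret bounded_linear l by (fact l)
  have "Ck_on k S (\<lambda>v. M0 + l v *\<^sub>R M1 + (l v)\<^sup>2 *\<^sub>R M2)" for k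
  proof (induction k arbitrary: M0 M1 M2)
    case 0
    have "continuous_on S l" by (rule linear_continuous_on[OF l])
    then show ?case by (simp add: continuous_intros)
  next
    case (Suc k)
    show ?case
    proof (rule Ck_on_SucI[OF _ \<open>open S\<close>])
      show "((\<lambda>v. M0 + l v *\<^sub>R M1 + (l v)\<^sup>2 *\<^sub>R M2) has_derivative
          (\<lambda>w. l w *\<^sub>R M1 + l v *\<^sub>R ((2 * l w) *\<^sub>R M2) + (l v)\<^sup>2 *\<^sub>R 0)) (at v)" for v
        by (auto intro!: derivative_eq_intros bounded_linear_imp_has_derivative l ext 
            simp: algebra_simps)
    qed (rule Suc)
  qed
  then show ?thesis by (simp add: smooth_on_def)
qed

text \<open>The same induction on the coefficients: the span of sine and cosine is closed under
  directional derivatives.\<close>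

lemma smooth_on_trig:
  fixes l :: "'a::real_normed_vector \<Rightarrow> real"
  assumes l: "bounded_linear l" and "open S"
  shows "smooth_on S (\<lambda>v. a * cos (l v) + b * sin (l v))"
proof -
  have "Ck_on k S (\<lambda>v. a * cos (l v) + b * sin (l v))" for k
  proof (induction k arbitrary: a b)
    case 0
    have "continuous_on S l" by (rule linear_continuous_on[OF l])
    then show ?case by (simp add: continuous_intros)
  next
    case (Suc k)
    show ?case
    proof (rule Ck_on_SucI[OF _ \<open>open S\<close>])
      show "((\<lambda>v. a * cos (l v) + b * sin (l v)) has_derivative
          (\<lambda>w. (b * l w) * cos (l v) + (- a * l w) * sin (l v))) (at v)" for v
        by (auto intro!: derivative_eq_intros bounded_linear_imp_has_derivative l ext 
            simp: algebra_simps)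
    qed (rule Suc)
  qed
  then show ?thesis by (simp add: smooth_on_def)
qed

lemma smooth_on_affine:
  assumes l: "bounded_linear l" and "open S"
  shows "smooth_on S (\<lambda>v. l v + b)"
proof -
  have const: "Ck_on k S (\<lambda>v. d)" for k and d :: 'b
    using smooth_on_quadratic[of "\<lambda>_. 0" S d 0 0] \<open>open S\<close> by (simp add: smooth_on_def)
  have "Ck_on k S (\<lambda>v. l v + b)" for k
  proof (cases k)
    case 0
    then show ?thesis
      by (simp add: continuous_on_add linear_continuous_on l)
  next
    case (Suc k)
    have "((\<lambda>v. l v + b) has_derivative l) (at v)" for v
      by (auto intro!: derivative_eq_intros bounded_linear_imp_has_derivative l)
    then show ?thesis unfolding Suc by (intro Ck_on_SucI[OF _ \<open>open S\<close> const])
  qed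
  then show ?thesis by (simp add: smooth_on_def)
qed

section \<open>The Heisenberg lattice and its quotient\<close>

text \<open>Three coordinates carry the Heisenberg group, and \<open>t\<close> is the flat direction
  against which the hyperplanes are tilted. The remaining coordinates are flat as well.\<close>

locale heisenberg =
  fixes x y z t :: "'n::finite"
  assumes distinct: "distinct [x, y, z, t]"
begin

lemma neq [simp]:
  "x \<noteq> y" "x \<noteq> z" "x \<noteq> t" "y \<noteq> x" "y \<noteq> z" "y \<noteq> t"
  "z \<noteq> x" "z \<noteq> y" "z \<noteq> t" "t \<noteq> x" "t \<noteq> y" "t \<noteq> z"
  using distinct by auto

section \<open>The group law, the integer lattice and its orbits\<close>

definition mul :: "real^'n \<Rightarrow> real^'n \<Rightarrow> real^'n" where
  "mul a v = a + v + axis z (a $ x * v $ y)"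

definition minv :: "real^'n \<Rightarrow> real^'n" where
  "minv a = - a + axis z (a $ x * a $ y)"

definition \<Gamma> :: "(real^'n) set" where
  "\<Gamma> = {m. \<forall>i. m $ i \<in> \<int>}"

text \<open>The right coset \<open>\<Gamma> v\<close> itself is the point of the quotient, so the
  manifold lives in the type \<open>(real^'n) set\<close>.\<close>

definition orb :: "real^'n \<Rightarrow> (real^'n) set" where
  "orb v = (\<lambda>m. mul m v) ` \<Gamma>"

lemma mul_nth: "mul a v $ i = a $ i + v $ i + (if i = z then a $ x * v $ y else 0)"
  by (simp add: mul_def axis_def)

lemma minv_nth: "minv a $ i = - a $ i + (if i = z then a $ x * a $ y else 0)"
  by (simp add: minv_def axis_def)

text \<open>\<open>mul\<close> models the product of upper unitriangular 3 by 3 matrices with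
  \<open>x\<close>, \<open>y\<close> next to the diagonal and \<open>z\<close> in the corner, times
  an additive group in the other coordinates.\<close>

lemma mul_assoc: "mul (mul a b) c = mul a (mul b c)"
  by (simp add: vec_eq_iff mul_nth algebra_simps)

lemma mul_0 [simp]: "mul 0 v = v" "mul v 0 = v"
  by (simp_all add: vec_eq_iff mul_nth)

lemma mul_minv [simp]: "mul (minv a) a = 0" "mul a (minv a) = 0"
  by (simp_all add: vec_eq_iff mul_nth minv_nth)

lemma mul_minv_cancel [simp]: "mul (minv a) (mul a v) = v" "mul a (mul (minv a) v) = v"
  by (simp_all flip: mul_assoc)

lemma mul_cancel_left [simp]: "mul a v = mul a w \<longleftrightarrow> v = w"
  by (metis mul_minv_cancel(1))

lemma mul_cancel_right [simp]: "mul a v = mul b v \<longleftrightarrow> a = b"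
  by (metis mul_assoc mul_minv(2) mul_0(2))

lemma \<Gamma>_0 [simp]: "0 \<in> \<Gamma>" and \<Gamma>_mul: "m \<in> \<Gamma> \<Longrightarrow> m' \<in> \<Gamma> \<Longrightarrow> mul m m' \<in> \<Gamma>"
  and \<Gamma>_minv: "m \<in> \<Gamma> \<Longrightarrow> minv m \<in> \<Gamma>"
  by (auto simp: \<Gamma>_def mul_nth minv_nth)

lemma orb_refl [simp]: "v \<in> orb v"
  unfolding orb_def by (force intro: image_eqI[of _ _ 0])

lemma orb_mul: "m \<in> \<Gamma> \<Longrightarrow> orb (mul m v) = orb v"
proof -
  assume m: "m \<in> \<Gamma>"
  have "mul m' v \<in> (\<lambda>m'. mul m' (mul m v)) ` \<Gamma>" if "m' \<in> \<Gamma>" for m'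
    using that m by (intro image_eqI[of _ _ "mul m' (minv m)"]) (auto simp: mul_assoc \<Gamma>_mul \<Gamma>_minv)
  moreover have "mul m' (mul m v) \<in> (\<lambda>m'. mul m' v) ` \<Gamma>" if "m' \<in> \<Gamma>" for m'
    using that m by (intro image_eqI[of _ _ "mul m' m"]) (auto simp: mul_assoc \<Gamma>_mul)
  ultimately show ?thesis by (auto simp: orb_def)
qed

lemma orb_eq_iff: "orb v = orb w \<longleftrightarrow> (\<exists>m\<in>\<Gamma>. w = mul m v)"
proof
  assume "orb v = orb w"
  then have "w \<in> orb v" by simp
  then show "\<exists>m\<in>\<Gamma>. w = mul m v" by (auto simp: orb_def)
qed (auto simp: orb_mul)

lemma mem_orb_iff: "w \<in> orb v \<longleftrightarrow> orb w = orb v"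
proof -
  have "w \<in> orb v \<longleftrightarrow> (\<exists>m\<in>\<Gamma>. w = mul m v)" by (auto simp: orb_def)
  then show ?thesis using orb_eq_iff[of v w] by auto
qed

lemma mul_affine: "mul m (v + b) = (v + axis z (m $ x * v $ y)) + mul m b"
  by (simp add: vec_eq_iff mul_nth axis_def algebra_simps)

lemma bounded_linear_shear: "bounded_linear (\<lambda>v::real^'n. v + axis z (c * v $ y))"
  by (intro linear_linear[THEN iffD2] linearI)
    (simp_all add: vec_eq_iff axis_def algebra_simps)

lemma mul_eq_shear: "mul m v = (v + axis z (m $ x * v $ y)) + m"
  using mul_affine[of m v 0] by simp

lemma continuous_on_mul [continuous_intros]: "continuous_on S f \<Longrightarrow> continuous_on S (\<lambda>v. mul m (f v))"
  unfolding mul_eq_shear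
  by (intro continuous_intros continuous_on_compose2[OF linear_continuous_on[OF bounded_linear_shear[of "m $ x"], of UNIV]]) auto

lemma open_mul_vimage: "open S \<Longrightarrow> open (mul m -` S)"
  by (intro open_vimage continuous_intros)

lemma mul_image: "mul m ` S = mul (minv m) -` S"
  by (force intro: image_eqI[of _ _ "mul (minv m) _"])

lemma open_mul_image: "open S \<Longrightarrow> open (mul m ` S)"
  by (simp add: mul_image open_mul_vimage)

section \<open>Proper discontinuity of the lattice action\<close>

lemma int_small: "a \<in> \<int> \<Longrightarrow> \<bar>a\<bar> < 1 \<Longrightarrow> a = (0::real)"
  by (auto elim!: Ints_cases)

text \<open>Outside \<open>z\<close> the displacement \<open>mul m v - v\<close> has the integer
  coordinates of \<open>m\<close>, which are below 1 in size and hence 0. Then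
  \<open>m $ x = 0\<close> removes the shear term, and the same holds for \<open>z\<close>. The
  bound 1 is uniform in \<open>v\<close>.\<close>

lemma \<Gamma>_separated: "m \<in> \<Gamma> \<Longrightarrow> dist (mul m v) v < 1 \<Longrightarrow> m = 0"
proof -
  assume m: "m \<in> \<Gamma>" and d: "dist (mul m v) v < 1"
  have *: "\<bar>(mul m v - v) $ i\<bar> < 1" for i
    using d component_le_norm_cart[of "mul m v - v" i] by (simp add: dist_norm)
  have ni: "m $ i = 0" if "i \<noteq> z" for i
    using *[of i] m that by (intro int_small) (auto simp: \<Gamma>_def mul_nth)
  have "m $ z = 0"
    using *[of z] m ni[of x] by (intro int_small) (auto simp: \<Gamma>_def mul_nth)
  with ni show "m = 0" by (metis vec_eq_iff zero_index)
qed

lemma inj_on_orb: "B \<subseteq> ball u (1/2) \<Longrightarrow> inj_on orb B"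
proof (rule inj_onI)
  fix v w assume B: "B \<subseteq> ball u (1/2)" "v \<in> B" "w \<in> B" "orb v = orb w"
  then obtain m where m: "m \<in> \<Gamma>" "w = mul m v" by (auto simp: orb_eq_iff)
  have "dist u v < 1/2" "dist u w < 1/2" using B by auto
  then have "dist w v < 1"
    using dist_triangle[of w v u] dist_commute[of w u] by linarith
  with m show "v = w" using \<Gamma>_separated by fastforce
qed

lemma closed_orb: "closed (orb v)"
proof (rule discrete_imp_closed[of 1])
  show "\<forall>w\<in>orb v. \<forall>w'\<in>orb v. dist w' w < 1 \<longrightarrow> w' = w"
  proof (intro ballI impI)
    fix w w' assume "w \<in> orb v" "w' \<in> orb v" "dist w' w < 1"
    then show "w' = w"
      using \<Gamma>_separated by (metis mem_orb_iff mul_0(1) orb_eq_iff)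
  qed
qed simp

section \<open>The quotient topology: second countable, compact and connected\<close>

definition X :: "(real^'n) set topology" where
  "X = topology (\<lambda>U. U \<subseteq> range orb \<and> open (orb -` U))"

lemma openin_X: "openin X U \<longleftrightarrow> U \<subseteq> range orb \<and> open (orb -` U)"
proof -
  have "istopology (\<lambda>U. U \<subseteq> range orb \<and> open (orb -` U))"
    unfolding istopology_def
  proof (intro conjI allI impI)
    fix K assume K: "\<forall>U\<in>K. U \<subseteq> range orb \<and> open (orb -` U)"
    then show "\<Union>K \<subseteq> range orb" by blast
    show "open (orb -` \<Union>K)" unfolding vimage_Union using K by blast
  qed (auto simp: vimage_Int)
  then show ?thesis by (simp add: X_def)
qed

lemma topspace_X: "topspace X = range orb"
proof
  show "topspace X \<subseteq> range orb" using openin_topspace[of X] unfolding openin_X by (rule conjunct1)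
  have "orb -` range orb = UNIV" by blast
  then have "openin X (range orb)" by (simp add: openin_X)
  then show "range orb \<subseteq> topspace X" by (rule openin_subset)
qed

lemma closedin_X: "closedin X C \<longleftrightarrow> C \<subseteq> range orb \<and> closed (orb -` C)"
proof -
  have "orb -` (range orb - C) = - orb -` C" by auto
  then show ?thesis by (auto simp: closedin_def topspace_X openin_X closed_def)
qed

lemma vimage_orb_image: "orb -` orb ` S = (\<Union>m\<in>\<Gamma>. mul m ` S)"
proof (intro set_eqI iffI)
  fix w assume "w \<in> orb -` orb ` S"
  then obtain v where "v \<in> S" "orb v = orb w" by fastforce
  then show "w \<in> (\<Union>m\<in>\<Gamma>. mul m ` S)" by (auto simp: orb_eq_iff)
qed (auto simp: orb_mul)

lemma openin_orb_image: "open S \<Longrightarrow> openin X (orb ` S)"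
  by (auto simp: openin_X vimage_orb_image intro: open_mul_image)

lemma continuous_map_orb: "continuous_map euclidean X orb"
  by (auto simp: continuous_map_def openin_X topspace_X vimage_def)

lemma open_map_orb: "open_map euclidean X orb"
  by (simp add: open_map_def openin_orb_image)

lemma second_countable_X: "second_countable X"
proof (rule second_countable_open_map_image[OF continuous_map_orb open_map_orb])
  obtain \<B> :: "(real^'n) set set" where "countable \<B>" "topological_basis \<B>"
    using ex_countable_basis by blast
  then show "second_countable (euclidean :: (real^'n) topology)"
    unfolding second_countable_def
    by (metis open_openin topological_basisE topological_basis_open)
qed (simp add: topspace_X)

lemma exists_rep_in_cube: "\<exists>m\<in>\<Gamma>. mul m v \<in> cbox 0 1"
proof
  \<comment> \<open>Translating by \<open>m\<close> with
    \<open>m $ x = - of_int \<lfloor>v $ x\<rfloor>\<close> also changes the \<open>z\<close>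
    coordinate by \<open>m $ x * v $ y\<close>, so the floor in the \<open>z\<close> entry is taken
    after that change.\<close>
  let ?m = "(\<chi> i. if i = z then - of_int \<lfloor>v $ z - of_int \<lfloor>v $ x\<rfloor> * v $ y\<rfloor> else - of_int \<lfloor>v $ i\<rfloor>) :: real^'n"
  show "?m \<in> \<Gamma>" by (auto simp: \<Gamma>_def)
  show "mul ?m v \<in> cbox 0 1"
    unfolding mem_box_cart
  proof
    fix i
    have "0 \<le> r - of_int \<lfloor>r\<rfloor> \<and> r - of_int \<lfloor>r\<rfloor> \<le> 1" for r :: real by linarith
    from this[of "v $ i"] this[of "v $ z - of_int \<lfloor>v $ x\<rfloor> * v $ y"]
    show "0 $ i \<le> mul ?m v $ i \<and> mul ?m v $ i \<le> 1 $ i"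
      by (auto simp: mul_nth; linarith)
  qed
qed

lemma topspace_X_cube: "topspace X = orb ` cbox 0 1"
proof -
  have "orb v \<in> orb ` cbox 0 1" for v
    using exists_rep_in_cube[of v] orb_mul by (metis image_eqI)
  then show ?thesis by (auto simp: topspace_X)
qed

lemma compact_X: "compact_space X"
proof -
  have "compactin X (orb ` cbox 0 1)"
    by (intro image_compactin[OF _ continuous_map_orb]) simp
  then show ?thesis by (simp add: compact_space_def topspace_X_cube)
qed

lemma connected_X: "connected_space X"
  using connectedin_continuous_map_image[OF continuous_map_orb, of UNIV]
  by (simp add: topspace_X convex_connected flip: connectedin_topspace)

section \<open>Charts, and an embedding into a normed space\<close>

text \<open>The offset \<open>b\<close> recentres the chart. It is 0 in the atlas; the slice charts
  of the leaves use it to turn an affine hyperplane into a linear subspace.\<close>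

definition chart :: "(real^'n) set \<Rightarrow> real^'n \<Rightarrow> ((real^'n) set, 'n) chart" where
  "chart B b = (orb ` B, \<lambda>P. inv_into B orb P - b)"

definition A :: "((real^'n) set, 'n) chart set" where
  "A = range (\<lambda>u. chart (ball u (1/2)) 0)"

lemma chart_image:
  assumes "inj_on orb B"
  shows "(\<lambda>P. inv_into B orb P - b) ` orb ` B = (\<lambda>w. w - b) ` B"
  using assms by (simp add: image_image)

lemma inv_into_chart:
  assumes "inj_on orb B" "w + b \<in> B"
  shows "inv_into (orb ` B) (\<lambda>P. inv_into B orb P - b) w = orb (w + b)"
proof (rule inv_into_f_eq)
  show "inj_on (\<lambda>P. inv_into B orb P - b) (orb ` B)"
    using assms(1) by (auto simp: inj_on_def)
qed (use assms in auto)

text \<open>The inverse of the coordinate map is \<open>orb\<close> after a translation. It is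
  continuous, open because \<open>orb\<close> is open, and injective on the translated
  \<open>B\<close>, hence a homeomorphism onto its image.\<close>

lemma is_chart_chart:
  assumes B: "open B" and inj: "inj_on orb B"
  shows "is_chart X (chart B b)"
proof -
  let ?\<phi> = "\<lambda>P. inv_into B orb P - b" and ?B = "(\<lambda>w. w - b) ` B"
  let ?\<psi> = "\<lambda>w. orb (w + b)"
  have "open ((\<lambda>w. w + (- b)) ` B)"
    using B open_translation[of B "- b"] by (simp add: add.commute)
  then have oB: "open ?B" by simp
  have "continuous_map (top_of_set ?B) (subtopology X (orb ` B)) ?\<psi>"
  proof -
    have "continuous_map (top_of_set ?B) X (orb \<circ> (\<lambda>w. w + b))"
      by (rule continuous_map_compose[OF _ continuous_map_orb]) (simp add: continuous_intros)
    then show ?thesis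
      by (auto simp: continuous_map_in_subtopology o_def)
  qed
  moreover have "open_map (top_of_set ?B) (subtopology X (orb ` B)) ?\<psi>"
  proof (rule open_map_into_subtopology)
    show "open_map (top_of_set ?B) X ?\<psi>"
      unfolding open_map_def
    proof (intro allI impI)
      fix U assume "openin (top_of_set ?B) U"
      then have "open U" using oB openin_open_trans by blast
      then have "open ((\<lambda>w. b + w) ` U)" by (rule open_translation)
      then show "openin X (?\<psi> ` U)"
        using openin_orb_image[of "(\<lambda>w. b + w) ` U"] by (simp add: image_image add.commute)
    qed
  qed auto
  moreover have "inj_on ?\<psi> ?B" "?\<psi> ` ?B = orb ` B"
    using inj by (auto simp: inj_on_def image_image)
  ultimately have "homeomorphic_map (top_of_set ?B) (subtopology X (orb ` B)) ?\<psi>"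
    by (intro bijective_open_imp_homeomorphic_map)
      (auto simp: openin_orb_image[OF B, THEN openin_subset] Int_absorb1)
  then obtain g where g: "homeomorphic_maps (top_of_set ?B) (subtopology X (orb ` B)) ?\<psi> g"
    by (auto simp: homeomorphic_map_maps)
  have sub: "topspace (subtopology X (orb ` B)) = orb ` B"
    using openin_orb_image[OF B, THEN openin_subset] by auto
  have "g P = ?\<phi> P" if P: "P \<in> orb ` B" for P
  proof -
    obtain w where w: "w \<in> B" "P = orb w" using P by blast
    then have "g (?\<psi> (w - b)) = w - b" using g by (auto simp: homeomorphic_maps_def)
    with w inj show ?thesis by simp
  qed
  then have "homeomorphic_maps (top_of_set ?B) (subtopology X (orb ` B)) ?\<psi> ?\<phi>"
    by (intro homeomorphic_maps_eq[OF g]) (auto simp: sub)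
  then have "homeomorphic_map (subtopology X (orb ` B)) (top_of_set ?B) ?\<phi>"
    unfolding homeomorphic_map_maps using homeomorphic_maps_sym by blast
  with oB openin_orb_image[OF B] show ?thesis
    by (simp add: is_chart_def chart_def chart_image[OF inj])
qed

text \<open>The point of \<open>C\<close> over \<open>orb v\<close> is \<open>mul m v\<close> for
  some lattice element. The same \<open>m\<close> moves a whole neighbourhood of \<open>v\<close>
  into \<open>C\<close>, where injectivity of \<open>orb\<close> forces the local inverse to be
  \<open>mul m\<close>.\<close>

lemma inv_into_orb_local:
  assumes C: "open C" "inj_on orb C" and "orb v \<in> orb ` C"
  obtains m U where "m \<in> \<Gamma>" "open U" "v \<in> U" "\<And>u. u \<in> U \<Longrightarrow> mul m u \<in> C"
    "\<And>u. u \<in> U \<Longrightarrow> inv_into C orb (orb u) = mul m u"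
proof -
  obtain w where w: "w \<in> C" "orb v = orb w" using assms by blast
  then obtain m where m: "m \<in> \<Gamma>" "w = mul m v" by (auto simp: orb_eq_iff)
  show ?thesis
  proof
    show "open (mul m -` C)" by (rule open_mul_vimage[OF C(1)])
    show "inv_into C orb (orb u) = mul m u" if "u \<in> mul m -` C" for u
      using that C(2) m(1) by (metis inv_into_f_f orb_mul vimageD)
  qed (use w m in auto)
qed

text \<open>Locally the map is a left translation, which is affine. The offset \<open>b\<close>
  covers both recentred charts and, later, the flow along \<open>t\<close>.\<close>

lemma smooth_on_inv_into_orb:
  assumes C: "open C" "inj_on orb C" and S: "\<And>v. v \<in> S \<Longrightarrow> orb (v + b) \<in> orb ` C"
  shows "smooth_on S (\<lambda>v. inv_into C orb (orb (v + b)) + d)"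
proof (rule smooth_on_cong_local)
  fix v assume "v \<in> S"
  then obtain m U where m: "m \<in> \<Gamma>" and U: "open U" "v + b \<in> U"
      and inv: "\<And>u. u \<in> U \<Longrightarrow> inv_into C orb (orb u) = mul m u"
    using inv_into_orb_local[OF C S] by metis
  have oU: "open ((\<lambda>u. u + b) -` U)"
    by (intro open_vimage U continuous_intros)
  show "\<exists>U g. open U \<and> v \<in> U \<and> smooth_on U g \<and> (\<forall>y\<in>U. inv_into C orb (orb (y + b)) + d = g y)"
  proof (intro exI conjI)
    show "smooth_on ((\<lambda>u. u + b) -` U) (\<lambda>u. (u + axis z (m $ x * u $ y)) + (mul m b + d))"
      by (rule smooth_on_affine[OF bounded_linear_shear oU])
  qed (use oU U inv in \<open>auto simp: mul_affine add.assoc\<close>)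
qed

lemma smooth_on_eq:
  assumes "smooth_on S f" "open S" "\<And>v. v \<in> S \<Longrightarrow> g v = f v"
  shows "smooth_on S g"
  using assms by (intro smooth_on_cong_local) blast

lemma open_chart_overlap:
  assumes B: "open B" "inj_on orb B" and W: "openin X W" "W \<subseteq> orb ` B"
  shows "open ((\<lambda>P. inv_into B orb P - b) ` W)"
proof -
  have "(\<lambda>P. inv_into B orb P - b) ` W = (\<lambda>w. w + b) -` (B \<inter> orb -` W)"
  proof (intro set_eqI iffI)
    fix w assume "w \<in> (\<lambda>w. w + b) -` (B \<inter> orb -` W)"
    then show "w \<in> (\<lambda>P. inv_into B orb P - b) ` W"
      using B(2) by (intro image_eqI[of _ _ "orb (w + b)"]) auto
  qed (use W B in \<open>auto simp: inv_into_into f_inv_into_f subset_eq\<close>)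
  moreover have "open \<dots>"
    using W B by (intro open_vimage continuous_intros) (auto simp: openin_X)
  ultimately show ?thesis by simp
qed

lemma smooth_chart_overlap:
  assumes B: "open B" "inj_on orb B" and C: "open C" "inj_on orb C"
  shows "smooth_on ((\<lambda>P. inv_into B orb P - b) ` (orb ` B \<inter> orb ` C))
    ((\<lambda>P. inv_into C orb P - d) \<circ> inv_into (orb ` B) (\<lambda>P. inv_into B orb P - b))"
    (is "smooth_on ?S _")
proof (rule smooth_on_eq)
  have *: "w + b \<in> B \<and> orb (w + b) \<in> orb ` C" if "w \<in> ?S" for w
  proof -
    from that obtain P where P: "P \<in> orb ` B" "P \<in> orb ` C" "w = inv_into B orb P - b" by blast
    then show ?thesis using f_inv_into_f[OF P(1)] inv_into_into[OF P(1)] by simp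
  qed
  show "smooth_on ?S (\<lambda>v. inv_into C orb (orb (v + b)) + (- d))"
    using * by (intro smooth_on_inv_into_orb C) auto
  show "open ?S"
    by (intro open_chart_overlap B openin_Int openin_orb_image C) auto
  show "((\<lambda>P. inv_into C orb P - d) \<circ> inv_into (orb ` B) (\<lambda>P. inv_into B orb P - b)) v
      = inv_into C orb (orb (v + b)) + (- d)" if "v \<in> ?S" for v
    using *[OF that] by (simp add: inv_into_chart B)
qed

lemma compatible_charts_chart:
  assumes "open B" "inj_on orb B" "open C" "inj_on orb C"
  shows "compatible_charts (chart B b) (chart C d)"
  using smooth_chart_overlap[OF assms] smooth_chart_overlap[OF assms(3,4,1,2)]
  by (simp add: compatible_charts_def chart_def Int_commute)

lemma A_cases:
  assumes "c \<in> A"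
  obtains B where "open B" "inj_on orb B" "c = chart B 0"
proof -
  obtain u where "c = chart (ball u (1/2)) 0" using assms by (auto simp: A_def)
  then show ?thesis using that inj_on_orb by blast
qed

text \<open>
  Embedding of the quotient into a normed space, where the covering space theory of
  HOL-Analysis applies. The weight compensates for the fact that \<open>\<Gamma>\<close> does not act by Euclidean isometries.
\<close>

definition emb_fun :: "real^'n \<Rightarrow> real^'n \<Rightarrow> real" where
  "emb_fun v w = infdist w (orb v) / (1 + norm w)"

lemma orb_ne [simp]: "orb v \<noteq> {}" using orb_refl by blast

lemma norm_axis_real: "norm (axis i c :: real^'n) = \<bar>c\<bar>"
proof -
  have "(axis i c :: real^'n) = c *\<^sub>R axis i 1" by (simp add: vec_eq_iff axis_def)
  then show ?thesis by simp
qed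

text \<open>Carry the nearest point \<open>mul m v\<close> of the first orbit to
  \<open>mul m v'\<close>. The shear enlarges \<open>v' - v\<close> by at most
  \<open>\<bar>m $ x\<bar>\<close>, and \<open>m $ x\<close> is bounded through the distance from
  \<open>mul m v\<close> to \<open>v\<close>. The resulting growth in \<open>norm w\<close> is what
  the weight in \<open>emb_fun\<close> absorbs.\<close>

lemma infdist_orb_le:
  "infdist w (orb v') \<le> infdist w (orb v) + (1 + 2 * norm w + 2 * norm v) * norm (v' - v)"
proof -
  obtain p where p: "p \<in> orb v" "infdist w (orb v) = dist w p"
    using infdist_attains_inf[OF closed_orb orb_ne] by blast
  then obtain m where m: "m \<in> \<Gamma>" "p = mul m v" by (auto simp: orb_def)
  have "dist w p \<le> dist w v" using p infdist_le[of v "orb v" w] by simp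
  also have "\<dots> \<le> norm w + norm v" by (simp add: dist_norm norm_triangle_ineq4)
  finally have dwp: "dist w p \<le> norm w + norm v" .
  have "m $ x = (p - v) $ x" by (simp add: m mul_nth)
  then have "\<bar>m $ x\<bar> \<le> norm (p - v)" by (metis component_le_norm_cart)
  also have "p - v = (p - w) + (w - v)" by simp
  also have "norm \<dots> \<le> dist w p + (norm w + norm v)"
    using norm_triangle_ineq[of "p - w" "w - v"] norm_triangle_ineq4[of w v]
    by (simp add: dist_norm norm_minus_commute)
  finally have mx: "\<bar>m $ x\<bar> \<le> 2 * norm w + 2 * norm v" using dwp by simp
  have "mul m v' \<in> orb v'" by (simp add: orb_def m)
  then have "infdist w (orb v') \<le> dist w (mul m v')" by (rule infdist_le)
  also have "\<dots> \<le> dist w p + dist p (mul m v')" by (rule dist_triangle)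
  also have "dist p (mul m v') = norm ((v' - v) + axis z (m $ x * (v' - v) $ y))"
  proof -
    have "mul m v' - p = (v' - v) + axis z (m $ x * (v' - v) $ y)"
      by (simp add: m vec_eq_iff mul_nth axis_def right_diff_distrib)
    then show ?thesis by (metis dist_commute dist_norm)
  qed
  also have "\<dots> \<le> norm (v' - v) + \<bar>m $ x\<bar> * \<bar>(v' - v) $ y\<bar>"
    using norm_triangle_ineq[of "v' - v" "axis z (m $ x * (v' - v) $ y)"]
    by (simp add: norm_axis_real abs_mult)
  also have "\<dots> \<le> norm (v' - v) + (2 * norm w + 2 * norm v) * norm (v' - v)"
    by (intro add_left_mono mult_mono mx component_le_norm_cart) auto
  finally show ?thesis by (simp add: p algebra_simps)
qed

lemma one_plus_norm_pos [simp]: "0 < 1 + norm w" "1 + norm w \<noteq> 0"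
  using norm_ge_zero[of w] by (linarith+)

lemma emb_fun_bcontfun: "emb_fun v \<in> bcontfun"
proof (rule bcontfun_normI)
  show "continuous_on UNIV (emb_fun v)"
    unfolding emb_fun_def
    by (intro continuous_intros) simp
  show "norm (emb_fun v w) \<le> 1 + norm v" for w
  proof -
    have "infdist w (orb v) \<le> dist w v" by (simp add: infdist_le)
    also have "\<dots> \<le> norm w + norm v" by (simp add: dist_norm norm_triangle_ineq4)
    also have "\<dots> \<le> (1 + norm v) * (1 + norm w)"
      by (simp add: algebra_simps)
    finally show ?thesis
      by (simp add: emb_fun_def pos_divide_le_eq infdist_nonneg)
  qed
qed

definition emb :: "real^'n \<Rightarrow> ((real^'n) \<Rightarrow>\<^sub>C real)" where
  "emb v = Bcontfun (emb_fun v)"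

lemma apply_emb: "apply_bcontfun (emb v) w = infdist w (orb v) / (1 + norm w)"
  by (simp add: emb_def Bcontfun_inverse emb_fun_bcontfun) (simp add: emb_fun_def)

lemma emb_diff_le:
  "apply_bcontfun (emb v') w - apply_bcontfun (emb v) w \<le> (2 + 2 * norm v) * norm (v' - v)"
proof -
  have "infdist w (orb v') - infdist w (orb v) \<le> (1 + 2 * norm w + 2 * norm v) * norm (v' - v)"
    using infdist_orb_le[of w v' v] by simp
  also have "\<dots> \<le> ((2 + 2 * norm v) * (1 + norm w)) * norm (v' - v)"
    by (intro mult_right_mono) (auto simp: algebra_simps)
  finally have "infdist w (orb v') - infdist w (orb v)
      \<le> ((2 + 2 * norm v) * norm (v' - v)) * (1 + norm w)" by (simp add: mult_ac)
  then show ?thesis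
    by (simp add: apply_emb pos_divide_le_eq flip: diff_divide_distrib)
qed

text \<open>A Lipschitz bound on balls, from the one-sided estimate used in both directions.\<close>

lemma dist_emb_le:
  assumes "norm v \<le> r" "norm v' \<le> r"
  shows "dist (emb v') (emb v) \<le> (2 + 2 * r) * norm (v' - v)"
proof (rule dist_bound)
  fix w
  have "(2 + 2 * norm v) * norm (v' - v) \<le> (2 + 2 * r) * norm (v' - v)"
    "(2 + 2 * norm v') * norm (v - v') \<le> (2 + 2 * r) * norm (v' - v)"
    using assms by (auto intro!: mult_right_mono simp: norm_minus_commute)
  with emb_diff_le[of v' w v] emb_diff_le[of v w v']
  show "dist (apply_bcontfun (emb v') w) (apply_bcontfun (emb v) w) \<le> (2 + 2 * r) * norm (v' - v)"
    by (simp add: dist_real_def abs_le_iff)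
qed

lemma continuous_on_emb: "continuous_on UNIV emb"
proof -
  have "isCont emb v" for v
  proof -
    have "((\<lambda>v'. (2 + 2 * (norm v + 1)) * norm (v' - v)) \<longlongrightarrow> (2 + 2 * (norm v + 1)) * norm (v - v)) (at v)"
      by (intro tendsto_intros)
    then have lim: "((\<lambda>v'. (2 + 2 * (norm v + 1)) * norm (v' - v)) \<longlongrightarrow> 0) (at v)" by simp
    have "\<forall>\<^sub>F v' in at v. dist (emb v') (emb v) \<le> (2 + 2 * (norm v + 1)) * norm (v' - v)"
      unfolding eventually_at
    proof (intro exI[of _ 1] conjI ballI impI)
      fix v' assume "v' \<noteq> v \<and> dist v' v < 1"
      then have "norm v' \<le> norm v + 1"
        using norm_triangle_sub[of v' v] by (simp add: dist_norm)
      then show "dist (emb v') (emb v) \<le> (2 + 2 * (norm v + 1)) * norm (v' - v)"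
        by (intro dist_emb_le) auto
    qed simp
    then have "((\<lambda>v'. dist (emb v') (emb v)) \<longlongrightarrow> 0) (at v)"
      by (intro Lim_null_comparison[OF _ lim]) simp
    then show ?thesis
      unfolding isCont_def by (rule tendsto_dist_iff[THEN iffD2])
  qed
  then show ?thesis by (simp add: continuous_on_eq_continuous_at)
qed

text \<open>Evaluation at \<open>w\<close> itself shows that \<open>w\<close> has distance 0 from
  \<open>orb v\<close>, and orbits are closed.\<close>

lemma emb_eq_iff: "emb v = emb w \<longleftrightarrow> orb v = orb w"
proof
  assume "emb v = emb w"
  then have "apply_bcontfun (emb v) w = apply_bcontfun (emb w) w" by simp
  then have "infdist w (orb v) = 0"
    by (simp add: apply_emb)
  then have "w \<in> orb v"
    using in_closed_iff_infdist_zero[OF closed_orb orb_ne] by blast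
  then show "orb v = orb w" by (simp add: mem_orb_iff)
next
  assume "orb v = orb w"
  then show "emb v = emb w" by (intro bcontfun_eqI) (simp add: apply_emb)
qed

section \<open>The embedding on the quotient, and the Hausdorff property\<close>

definition rep :: "(real^'n) set \<Rightarrow> real^'n" where
  "rep P = (SOME v. v \<in> P)"

lemma orb_rep: "P \<in> range orb \<Longrightarrow> orb (rep P) = P"
  unfolding rep_def by (metis mem_orb_iff orb_refl imageE someI)

lemma emb_rep_orb [simp]: "emb (rep (orb v)) = emb v"
  by (simp add: emb_eq_iff orb_rep)

lemma continuous_map_emb: "continuous_map X euclidean (emb \<circ> rep)"
proof -
  have "orb -` {P \<in> range orb. emb (rep P) \<in> U} = emb -` U" for U by auto
  then show ?thesis
    by (auto simp: continuous_map_def openin_X topspace_X intro: open_vimage continuous_on_emb)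
qed

lemma inj_on_emb: "inj_on (emb \<circ> rep) (topspace X)"
  by (auto simp: inj_on_def topspace_X emb_eq_iff orb_rep)

text \<open>Inherited from the normed space through the injective continuous map
  \<open>emb \<circ> rep\<close>.\<close>

lemma Hausdorff_X: "Hausdorff_space X"
  using Hausdorff_space_injective_preimage[OF Hausdorff_space_euclidean continuous_map_emb inj_on_emb] .

lemma smooth_manifold_X: "smooth_manifold X A"
  unfolding smooth_manifold_def
proof (intro conjI ballI)
  show "\<exists>\<B>. countable \<B> \<and> (\<forall>B\<in>\<B>. openin X B) \<and>
        (\<forall>U x. openin X U \<and> x \<in> U \<longrightarrow> (\<exists>B\<in>\<B>. x \<in> B \<and> B \<subseteq> U))"
    using second_countable_X by (auto simp: second_countable_def)
  show "\<Union> (fst ` A) = topspace X"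
    by (force simp: A_def chart_def topspace_X)
  show "is_chart X c" if "c \<in> A" for c
    using that by (metis A_cases is_chart_chart)
  show "compatible_charts c d" if "c \<in> A" "d \<in> A" for c d
    using that by (metis A_cases compatible_charts_chart)
qed (rule Hausdorff_X)

section \<open>The metric and the isoparametric functions\<close>

text \<open>A matrix unit, chosen so that the rows of \<open>mat 1 - (v $ x) *\<^sub>R N\<close> are
  the left invariant coframe: \<open>dz - x dy\<close> in row \<open>z\<close>, coordinate
  differentials elsewhere.\<close>

definition N :: "real^'n^'n" where
  "N = (\<chi> i j. if i = z \<and> j = y then 1 else 0)"

text \<open>
  \<open>T v\<close> is the differential at \<open>v\<close> of the left translation taking \<open>v\<close> to the identity, so \<open>G\<close> is left invariant.
\<close>

definition T :: "real^'n \<Rightarrow> real^'n^'n" where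
  "T v = mat 1 - (v $ x) *\<^sub>R N"

definition G :: "real^'n \<Rightarrow> real^'n^'n" where
  "G v = transpose (T v) ** T v"

lemma N_vec: "N *v a = axis z (a $ y)"
proof -
  have "(\<Sum>j\<in>UNIV. (if j = y then 1 else 0) * a $ j) = a $ y"
    by (simp add: if_distrib[of "\<lambda>r. r * _"] cong: if_cong)
  then show ?thesis
    by (simp add: vec_eq_iff N_def matrix_vector_mult_def axis_def)
qed

lemma vec_N: "a v* N = axis y (a $ z)"
proof -
  have "(\<Sum>j\<in>UNIV. a $ j * (if j = z then 1 else 0)) = a $ z"
    by (simp add: if_distrib[of "\<lambda>r. _ * r"] cong: if_cong)
  then show ?thesis
    by (simp add: vec_eq_iff N_def vector_matrix_mult_def axis_def)
qed

lemma T_vec: "T v *v a = a - axis z (v $ x * a $ y)"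
proof -
  have "((v $ x) *\<^sub>R N) *v a = (v $ x) *\<^sub>R (N *v a)"
    by (simp add: scaleR_matrix_vector_assoc)
  then show ?thesis
    by (simp add: T_def matrix_vector_mult_diff_rdistrib N_vec) (simp add: vec_eq_iff axis_def)
qed

lemma vec_T: "a v* T v = a - axis y (v $ x * a $ z)"
proof -
  have "a v* T v = a - (v $ x) *\<^sub>R (a v* N)"
    by (simp add: T_def vec_eq_iff vector_matrix_mult_def mat_def right_diff_distrib sum_subtractf
        sum_distrib_left mult.left_commute[of "v $ x"] if_distrib[of "\<lambda>r. _ * r"] cong: if_cong)
  then show ?thesis by (simp add: vec_N) (simp add: vec_eq_iff axis_def)
qed

lemma det_T: "det (T v) = 1"
proof -
  have "T v = (\<chi> k. if k = z then row z (mat 1) + (- v $ x) *s row y (mat 1) else row k (mat 1))"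
    by (auto simp: vec_eq_iff T_def N_def row_def mat_def)
  then show ?thesis by (simp add: det_row_operation)
qed

text \<open>The volume density is 1, so \<open>local_div\<close> becomes the Euclidean
  divergence.\<close>

lemma det_G: "det (G v) = 1"
  by (simp add: G_def det_mul det_transpose det_T)

lemma G_vec: "G v *v a = (T v *v a) v* T v"
  by (simp add: G_def flip: matrix_vector_mul_assoc)

lemma inner_G: "a \<bullet> (G v *v b) = (T v *v a) \<bullet> (T v *v b)"
  by (metis G_vec dot_lmul_matrix inner_commute)

text \<open>Expanding the product shows that \<open>G\<close> is quadratic in the single coordinate
  \<open>v $ x\<close>, with linear coefficient \<open>- (N + transpose N)\<close>.\<close>

lemma smooth_on_G: "open S \<Longrightarrow> smooth_on S G"
proof -
  assume S: "open S"
  define M where "M = - (N + transpose N)"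
  have sc: "(r *\<^sub>R M) *v a = r *\<^sub>R (M *v a)" for r a and M :: "real^'n^'n"
    by (simp add: scaleR_matrix_vector_assoc)
  have M_vec: "M *v a = - axis z (a $ y) - axis y (a $ z)" for a
    using sc[of "- 1" "N + transpose N" a]
    by (simp add: M_def matrix_vector_mult_add_rdistrib N_vec vec_N)
  have "G v = mat 1 + (v $ x) *\<^sub>R M + (v $ x)\<^sup>2 *\<^sub>R (transpose N ** N)" for v
    unfolding matrix_eq
  proof
    fix a :: "real^'n"
    have "(mat 1 + (v $ x) *\<^sub>R M + (v $ x)\<^sup>2 *\<^sub>R (transpose N ** N)) *v a
       = a + (v $ x) *\<^sub>R (- axis z (a $ y) - axis y (a $ z)) + (v $ x)\<^sup>2 *\<^sub>R axis y (axis z (a $ y) $ z)"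
      by (simp only: matrix_vector_mult_add_rdistrib sc M_vec N_vec vec_N matrix_vector_mul_lid
          transpose_matrix_vector flip: matrix_vector_mul_assoc)
    then show "G v *v a = (mat 1 + (v $ x) *\<^sub>R M + (v $ x)\<^sup>2 *\<^sub>R (transpose N ** N)) *v a"
      by (simp add: G_vec T_vec vec_T) (simp add: vec_eq_iff axis_def power2_eq_square algebra_simps)
  qed
  then show ?thesis
    using smooth_on_quadratic[OF bounded_linear_vec_nth S, of "mat 1" x M "transpose N ** N"]
    by presburger
qed

text \<open>One Gram matrix serves all charts of \<open>A\<close>: the coordinate changes are
  locally left translations by lattice elements, and these preserve \<open>G\<close>.\<close>

definition g :: "((real^'n) set, 'n) metric" where
  "g c v = G v"

text \<open>Left invariance of the coframe: \<open>w + axis z (m $ x * w $ y)\<close> is the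
  differential of \<open>mul m\<close> applied to \<open>w\<close>.\<close>

lemma T_mul: "T (mul m v) *v (w + axis z (m $ x * w $ y)) = T v *v w"
  by (simp add: T_vec vec_eq_iff mul_nth axis_def algebra_simps)

lemma riemannian_metric_g: "riemannian_metric A g"
  unfolding riemannian_metric_def
proof (intro conjI ballI case_prodI2)
  fix c U \<phi> assume "c \<in> A" "c = (U, \<phi>)"
  then obtain B where B: "open B" "inj_on orb B" and c: "(U, \<phi>) = chart B 0" by (metis A_cases)
  then have im: "\<phi> ` U = B" by (auto simp: chart_def)
  show "smooth_on (\<phi> ` U) (g (U, \<phi>))"
    using smooth_on_G[OF B(1)] im by (simp add: g_def[abs_def])
  show "transpose (g (U, \<phi>) v) = g (U, \<phi>) v" for v
    by (simp add: g_def G_def matrix_transpose_mul)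
  have "w \<bullet> (G v *v w) > 0" if "w \<noteq> 0" for v w
  proof -
    have "T v *v w \<noteq> 0"
    proof
      assume "T v *v w = 0"
      then have w: "w $ i = (if i = z then v $ x * w $ y else 0)" for i
        by (simp add: T_vec vec_eq_iff axis_def)
      from w[of y] have "w $ y = 0" by simp
      with w have "w = 0" by (simp add: vec_eq_iff)
      with that show False by simp
    qed
    then show ?thesis by (simp add: inner_G)
  qed
  then show "\<forall>w. w \<noteq> 0 \<longrightarrow> w \<bullet> (g (U, \<phi>) v *v w) > 0" for v
    by (simp add: g_def)
next
  fix c U \<phi> d V \<psi> p
  assume "c \<in> A" "c = (U, \<phi>)" "d \<in> A" "d = (V, \<psi>)" and p: "p \<in> U \<inter> V"
  then obtain B C where B: "open B" "inj_on orb B" and cU: "(U, \<phi>) = chart B 0"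
     and C: "open C" "inj_on orb C" and cV: "(V, \<psi>) = chart C 0" by (metis A_cases)
  have U: "U = orb ` B" "\<phi> = inv_into B orb" and V: "V = orb ` C" "\<psi> = inv_into C orb"
    using cU cV by (auto simp: chart_def)
  obtain v where v: "v \<in> B" "p = orb v" using p U by auto
  then have phi: "\<phi> p = v" using B U by simp
  have oC: "orb v \<in> orb ` C" using p v V by simp
  then obtain m O' where m: "m \<in> \<Gamma>" "open O'" "v \<in> O'" 
    and loc: "\<And>u. u \<in> O' \<Longrightarrow> inv_into C orb (orb u) = mul m u"
    using inv_into_orb_local[OF C oC] by metis
  \<comment> \<open>The differential of the coordinate change, which near \<open>v\<close> is left
    translation by \<open>m\<close>.\<close>
  let ?D = "\<lambda>w. w + axis z (m $ x * w $ y)"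
  have "(mul m has_derivative ?D) (at v)"
    unfolding mul_eq_shear[abs_def]
    by (rule has_derivative_add_const bounded_linear_imp_has_derivative bounded_linear_shear)+
  then have "(\<psi> \<circ> inv_into U \<phi> has_derivative ?D) (at v)"
  proof (rule has_derivative_transform_within_open)
    show "open (B \<inter> O')" "v \<in> B \<inter> O'" using B m v by auto
    show "mul m u = (\<psi> \<circ> inv_into U \<phi>) u" if "u \<in> B \<inter> O'" for u
      using that inv_into_chart[OF B(2), of u 0] loc[of u] by (simp add: U V)
  qed
  then have "?D = frechet_derivative (\<psi> \<circ> inv_into U \<phi>) (at (\<phi> p))"
    using phi frechet_derivative_at by metis
  moreover have "\<psi> p = mul m v" using loc m v V by simp
  moreover have "transpose (matrix ?D) ** G (mul m v) ** matrix ?D = G v"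
  proof -
    have TD: "T (mul m v) ** matrix ?D = T v"
      unfolding matrix_eq
      by (simp add: matrix_works bounded_linear_shear bounded_linear.linear T_mul flip: matrix_vector_mul_assoc)
    have "transpose (matrix ?D) ** G (mul m v) ** matrix ?D
      = transpose (T (mul m v) ** matrix ?D) ** (T (mul m v) ** matrix ?D)"
      by (simp add: G_def matrix_mul_assoc matrix_transpose_mul)
    then show ?thesis unfolding TD by (simp add: G_def)
  qed
  ultimately show "let J = matrix (frechet_derivative (\<psi> \<circ> inv_into U \<phi>) (at (\<phi> p)))
        in g (U, \<phi>) (\<phi> p) = transpose J ** g (V, \<psi>) (\<psi> p) ** J"
    by (simp add: g_def Let_def phi)
qed

lemma closed_riemannian_manifold_X: "closed_riemannian_manifold X A g"
  unfolding closed_riemannian_manifold_def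
  using smooth_manifold_X riemannian_metric_g compact_X connected_X by (simp add: topspace_X)

section \<open>The isoparametric functions, their gradient and Laplacian\<close>

definition lev :: "nat \<Rightarrow> real^'n \<Rightarrow> real" where
  "lev k v = v $ y + real k * v $ t"

text \<open>The Euclidean gradient of \<open>lev k\<close>.\<close>

definition slope :: "nat \<Rightarrow> real^'n" where
  "slope k = axis y 1 + axis t (real k)"

definition F :: "nat \<Rightarrow> (real^'n) set \<Rightarrow> real" where
  "F k P = cos (2 * pi * lev k (rep P))"

lemma bounded_linear_lev: "bounded_linear (lev k)"
  unfolding lev_def[abs_def]
  by (intro bounded_linear_add bounded_linear_const_mult bounded_linear_vec_nth)

text \<open>The twist of the group law sits in the \<open>z\<close> coordinate, which
  \<open>lev k\<close> does not see; hence a homomorphism to the additive reals.\<close>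

lemma lev_mul: "lev k (mul m v) = lev k m + lev k v"
  by (simp add: lev_def mul_nth algebra_simps)

lemma lev_\<Gamma>: "m \<in> \<Gamma> \<Longrightarrow> lev k m \<in> \<int>"
  by (auto simp: lev_def \<Gamma>_def)

lemma lev_axis: "lev k (axis i 1) = slope k $ i"
  by (auto simp: lev_def slope_def axis_def)

lemma F_orb: "F k (orb v) = cos (2 * pi * lev k v)"
proof -
  have "rep (orb v) \<in> orb v" using mem_orb_iff orb_rep by blast
  then obtain m where m: "m \<in> \<Gamma>" "rep (orb v) = mul m v" by (auto simp: orb_def)
  have "2 * pi * lev k v = 2 * pi * lev k (rep (orb v)) + 2 * (- lev k m) * pi"
    by (simp only: m(2) lev_mul) (simp add: algebra_simps)
  moreover have "- lev k m \<in> \<int>" using lev_\<Gamma>[OF m(1)] by (rule Ints_minus)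
  ultimately have "cos (2 * pi * lev k v) = cos (2 * pi * lev k (rep (orb v)))"
    unfolding cos_eq by blast
  then show ?thesis by (simp add: F_def)
qed

lemma F_chart:
  assumes "inj_on orb B" "v \<in> B"
  shows "F k (inv_into (orb ` B) (inv_into B orb) v) = cos (2 * pi * lev k v)"
  using inv_into_chart[of B v 0] assms by (simp add: F_orb)

lemma partial_derivI:
  assumes "(f has_derivative D) (at v)" shows "partial_deriv i f v = D (axis i 1)"
  using frechet_derivative_at[OF assms] by (simp add: partial_deriv_def)

text \<open>This is the Riemannian gradient of \<open>lev k\<close>. \<open>T v\<close> maps the
  vector on the right to \<open>slope k\<close>, and the transpose of \<open>T v\<close> fixes
  \<open>slope k\<close> because its \<open>z\<close> entry is 0.\<close>

lemma matrix_inv_G_slope: "matrix_inv (G v) *v slope k = slope k + axis z (v $ x)"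
proof -
  have "T v *v (slope k + axis z (v $ x)) = slope k"
    by (simp add: T_vec vec_eq_iff slope_def axis_def)
  then have "G v *v (slope k + axis z (v $ x)) = slope k"
    by (simp add: G_vec vec_T) (simp add: vec_eq_iff slope_def axis_def)
  moreover have "\<exists>M. G v ** M = mat 1 \<and> M ** G v = mat 1"
    using invertible_det_nz[of "G v"] by (simp add: invertible_def det_G)
  then have "matrix_inv (G v) ** G v = mat 1"
    unfolding matrix_inv_def by (rule someI2_ex) simp
  ultimately show ?thesis
    by (metis matrix_vector_mul_assoc matrix_vector_mul_lid)
qed

lemma local_grad_F:
  assumes B: "open B" "inj_on orb B" and v: "v \<in> B"
  shows "local_grad G (F k \<circ> inv_into (orb ` B) (inv_into B orb)) v
    = (- 2 * pi * sin (2 * pi * lev k v)) *\<^sub>R (slope k + axis z (v $ x))"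
proof -
  interpret l: bounded_linear "lev k" by (rule bounded_linear_lev)
  have "((\<lambda>v. cos (2 * pi * lev k v)) has_derivative (\<lambda>w. (- 2 * pi * sin (2 * pi * lev k v)) * lev k w)) (at v)"
    by (auto intro!: derivative_eq_intros bounded_linear_imp_has_derivative bounded_linear_lev ext)
  then have "(F k \<circ> inv_into (orb ` B) (inv_into B orb) has_derivative
     (\<lambda>w. (- 2 * pi * sin (2 * pi * lev k v)) * lev k w)) (at v)"
    by (rule has_derivative_transform_within_open[OF _ B(1) v]) (simp add: F_chart B)
  then have "(\<chi> i. partial_deriv i (F k \<circ> inv_into (orb ` B) (inv_into B orb)) v)
    = (- 2 * pi * sin (2 * pi * lev k v)) *\<^sub>R slope k"
    by (simp add: partial_derivI lev_axis vec_eq_iff)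
  then show ?thesis
    by (simp only: local_grad_def matrix_vector_mult_scaleR matrix_inv_G_slope)
qed

lemma slope_inner: "slope k \<bullet> slope k = 1 + (real k)\<^sup>2"
  by (simp add: slope_def inner_add_left inner_add_right inner_axis_axis power2_eq_square)

lemma local_laplacian_F:
  assumes B: "open B" "inj_on orb B" and v: "v \<in> B"
  shows "local_laplacian G (F k \<circ> inv_into (orb ` B) (inv_into B orb)) v
    = - 4 * pi\<^sup>2 * (1 + (real k)\<^sup>2) * cos (2 * pi * lev k v)"
proof -
  interpret l: bounded_linear "lev k" by (rule bounded_linear_lev)
  have "partial_deriv i (\<lambda>w. sqrt (det (G w)) *
      local_grad G (F k \<circ> inv_into (orb ` B) (inv_into B orb)) w $ i) v
    = - 4 * pi\<^sup>2 * cos (2 * pi * lev k v) * (slope k $ i * slope k $ i)" for i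
  proof -
    \<comment> \<open>\<open>?e * w $ x\<close> is entry \<open>i\<close> of
      \<open>axis z (w $ x)\<close>. It adds nothing to the divergence: for \<open>i = z\<close> the
      derivative is taken along \<open>z\<close>, where neither \<open>w $ x\<close> nor
      \<open>lev k\<close> changes.\<close>
    let ?e = "if i = z then 1 else 0 :: real"
    have "((\<lambda>w. (- 2 * pi * sin (2 * pi * lev k w)) * (slope k $ i + ?e * w $ x)) has_derivative
        (\<lambda>h. (- 2 * pi * sin (2 * pi * lev k v)) * (?e * h $ x)
           + (- 4 * pi\<^sup>2 * cos (2 * pi * lev k v) * lev k h) * (slope k $ i + ?e * v $ x))) (at v)"
      by (auto intro!: derivative_eq_intros bounded_linear_imp_has_derivative bounded_linear_lev
            bounded_linear_vec_nth ext simp: power2_eq_square)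
    then have "((\<lambda>w. sqrt (det (G w)) * local_grad G (F k \<circ> inv_into (orb ` B) (inv_into B orb)) w $ i)
       has_derivative (\<lambda>h. (- 2 * pi * sin (2 * pi * lev k v)) * (?e * h $ x)
           + (- 4 * pi\<^sup>2 * cos (2 * pi * lev k v) * lev k h) * (slope k $ i + ?e * v $ x))) (at v)"
      by (rule has_derivative_transform_within_open[OF _ B(1) v])
        (simp add: local_grad_F[OF B] det_G, simp add: axis_def)
    from partial_derivI[OF this, of i] show ?thesis
      by (auto simp: lev_axis) (auto simp: slope_def axis_def)
  qed
  then have "local_laplacian G (F k \<circ> inv_into (orb ` B) (inv_into B orb)) v
    = (\<Sum>i\<in>UNIV. - 4 * pi\<^sup>2 * cos (2 * pi * lev k v) * (slope k $ i * slope k $ i))"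
    by (simp add: local_laplacian_def local_div_def det_G)
  also have "\<dots> = - 4 * pi\<^sup>2 * cos (2 * pi * lev k v) * (slope k \<bullet> slope k)"
    by (simp only: sum_distrib_left inner_vec_def inner_real_def)
  finally show ?thesis by (simp add: slope_inner)
qed

text \<open>The gradient of \<open>lev k\<close> has the constant squared length
  \<open>1 + (real k)\<^sup>2\<close>, and the squared sine from the chain rule is
  \<open>1 - (F k P)\<^sup>2\<close>.\<close>

lemma grad_norm_F:
  assumes B: "open B" "inj_on orb B" and v: "v \<in> B"
  shows "grad_norm_sq_in g (chart B 0) (F k) (orb v) = 4 * pi\<^sup>2 * (1 + (real k)\<^sup>2) * (1 - (F k (orb v))\<^sup>2)"
proof -
  have "T v *v (slope k + axis z (v $ x)) = slope k"
    by (simp add: T_vec vec_eq_iff slope_def axis_def)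
  then have "(slope k + axis z (v $ x)) \<bullet> (G v *v (slope k + axis z (v $ x))) = 1 + (real k)\<^sup>2"
    by (simp add: inner_G slope_inner)
  then have "(r *\<^sub>R (slope k + axis z (v $ x))) \<bullet> (G v *v (r *\<^sub>R (slope k + axis z (v $ x)))) = r\<^sup>2 * (1 + (real k)\<^sup>2)" for r
    by (simp only: matrix_vector_mult_scaleR inner_scaleR_left inner_scaleR_right power2_eq_square mult.assoc)
  then have "grad_norm_sq_in g (chart B 0) (F k) (orb v)
     = (- 2 * pi * sin (2 * pi * lev k v))\<^sup>2 * (1 + (real k)\<^sup>2)"
    by (simp add: grad_norm_sq_in_def chart_def g_def[abs_def] Let_def B v local_grad_F[OF B v]
        del: scaleR_minus_left mult_minus_left)
  then show ?thesis
    by (simp add: F_orb sin_squared_eq power_mult_distrib)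
qed

lemma isoparametric_F: "isoparametric_function X A g (F k)"
  unfolding isoparametric_function_def
proof (intro conjI)
  show "smooth_function A (F k)"
    unfolding smooth_function_def
  proof clarify
    fix U \<phi> assume "(U, \<phi>) \<in> A"
    then obtain B where B: "open B" "inj_on orb B" and c: "(U, \<phi>) = chart B 0" by (rule A_cases)
    then have U: "U = orb ` B" "\<phi> = inv_into B orb" and im: "\<phi> ` U = B" by (auto simp: chart_def)
    have "smooth_on B (\<lambda>v. 1 * cos (2 * pi * lev k v) + 0 * sin (2 * pi * lev k v))"
      by (intro smooth_on_trig bounded_linear_const_mult bounded_linear_lev B)
    then show "smooth_on (\<phi> ` U) (F k \<circ> inv_into U \<phi>)"
      unfolding im unfolding U by (rule smooth_on_eq[OF _ B(1)]) (simp add: F_chart B)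
  qed
  show "\<not> F k constant_on topspace X"
  proof
    assume "F k constant_on topspace X"
    \<comment> \<open>At these two points the cosine takes the values 1 and -1.\<close>
    then have "F k (orb 0) = F k (orb (axis y (1/2)))"
      by (auto simp: constant_on_def topspace_X)
    then show False by (simp add: F_orb lev_def axis_def)
  qed
  have sm: "smooth_on UNIV (\<lambda>r::real. 4 * pi\<^sup>2 * (1 + (real k)\<^sup>2) * (1 - r\<^sup>2))"
    using smooth_on_quadratic[OF bounded_linear_ident open_UNIV, of "4 * pi\<^sup>2 * (1 + (real k)\<^sup>2)" 0
        "- (4 * pi\<^sup>2 * (1 + (real k)\<^sup>2))"]
    by (simp add: algebra_simps)
  have A_point: "\<exists>B v. open B \<and> inj_on orb B \<and> v \<in> B \<and> c = chart B 0 \<and> p = orb v"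
    if "c \<in> A" "p \<in> fst c" for c p
  proof -
    from that(1) obtain B where B: "open B" "inj_on orb B" "c = chart B 0" by (rule A_cases)
    with that(2) show ?thesis by (auto simp: chart_def)
  qed
  show "\<exists>b W. open W \<and> F k ` topspace X \<subseteq> W \<and> smooth_on W b \<and>
        (\<forall>(U, \<phi>)\<in>A. \<forall>p\<in>U. grad_norm_sq_in g (U, \<phi>) (F k) p = b (F k p))"
  proof (intro exI conjI)
    show "\<forall>(U, \<phi>)\<in>A. \<forall>p\<in>U. grad_norm_sq_in g (U, \<phi>) (F k) p = 4 * pi\<^sup>2 * (1 + (real k)\<^sup>2) * (1 - (F k p)\<^sup>2)"
    proof clarify
      fix U \<phi> p assume "(U, \<phi>) \<in> A" "p \<in> U"
      then obtain B v where "open B" "inj_on orb B" "v \<in> B" "(U, \<phi>) = chart B 0" "p = orb v"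
        using A_point[of "(U, \<phi>)" p] by auto
      then show "grad_norm_sq_in g (U, \<phi>) (F k) p = 4 * pi\<^sup>2 * (1 + (real k)\<^sup>2) * (1 - (F k p)\<^sup>2)"
        using grad_norm_F by metis
    qed
  qed (use sm in auto)
  show "\<exists>a. continuous_on (F k ` topspace X) a \<and>
        (\<forall>(U, \<phi>)\<in>A. \<forall>p\<in>U. laplacian_in g (U, \<phi>) (F k) p = a (F k p))"
  proof (intro exI conjI)
    show "\<forall>(U, \<phi>)\<in>A. \<forall>p\<in>U. laplacian_in g (U, \<phi>) (F k) p = - 4 * pi\<^sup>2 * (1 + (real k)\<^sup>2) * F k p"
    proof clarify
      fix U \<phi> p assume "(U, \<phi>) \<in> A" "p \<in> U"
      then obtain B v where B: "open B" "inj_on orb B" "v \<in> B" "(U, \<phi>) = chart B 0" "p = orb v"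
        using A_point[of "(U, \<phi>)" p] by auto
      then have U: "U = orb ` B" "\<phi> = inv_into B orb" by (auto simp: chart_def)
      show "laplacian_in g (U, \<phi>) (F k) p = - 4 * pi\<^sup>2 * (1 + (real k)\<^sup>2) * F k p"
        using local_laplacian_F[OF B(1-3), of k] B(3)
        by (simp add: laplacian_in_def U g_def[abs_def] B(2,5) F_orb)
    qed
  qed (intro continuous_intros)
qed

section \<open>The leaves\<close>

definition hyp :: "nat \<Rightarrow> real \<Rightarrow> (real^'n) set" where
  "hyp k s = {v. lev k v = s}"

definition leaf :: "nat \<Rightarrow> real \<Rightarrow> (real^'n) set set" where
  "leaf k s = orb ` hyp k s"

lemma orb_in_leaf: "orb v \<in> leaf k s \<longleftrightarrow> lev k v - s \<in> \<int>"
proof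
  assume "orb v \<in> leaf k s"
  then obtain w where w: "lev k w = s" "orb w = orb v" by (auto simp: leaf_def hyp_def)
  then obtain m where "m \<in> \<Gamma>" "v = mul m w" by (auto simp: orb_eq_iff)
  with w show "lev k v - s \<in> \<int>" by (simp add: lev_mul lev_\<Gamma>)
next
  assume *: "lev k v - s \<in> \<int>"
  \<comment> \<open>\<open>lev k\<close> has coefficient 1 at \<open>y\<close>, so this integer
    translation along \<open>y\<close> corrects the level to exactly \<open>s\<close>.\<close>
  let ?m = "axis y (s - lev k v) :: real^'n"
  have m: "?m \<in> \<Gamma>"
    using Ints_minus[OF *] by (simp add: \<Gamma>_def axis_def)
  have "lev k (mul ?m v) = s" by (simp add: lev_mul) (simp add: lev_def axis_def)
  then have "orb (mul ?m v) \<in> leaf k s" by (auto simp: leaf_def hyp_def)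
  then show "orb v \<in> leaf k s" by (simp add: orb_mul[OF m])
qed

lemma leaf_subset: "leaf k s \<subseteq> topspace X"
  by (auto simp: leaf_def topspace_X)

lemma leaf_cong: "s - s' \<in> \<int> \<Longrightarrow> leaf k s = leaf k s'"
proof -
  assume *: "s - s' \<in> \<int>"
  have "lev k v - s \<in> \<int> \<longleftrightarrow> lev k v - s' \<in> \<int>" for v
    using Ints_add[OF _ *, of "lev k v - s"] Ints_diff[OF _ *, of "lev k v - s'"] by auto
  then have "orb v \<in> leaf k s \<longleftrightarrow> orb v \<in> leaf k s'" for v by (simp add: orb_in_leaf)
  then show ?thesis using leaf_subset by (fastforce simp: topspace_X)
qed

lemma closedin_leaf: "closedin X (leaf k s)"
proof -
  have "orb -` leaf k s = lev k -` ((\<lambda>r. s + r) ` \<int>)"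
  proof (intro set_eqI)
    fix v
    have "lev k v - s \<in> \<int> \<longleftrightarrow> lev k v \<in> (\<lambda>r. s + r) ` \<int>"
      using image_eqI[of "lev k v" "\<lambda>r. s + r" "lev k v - s" \<int>] by auto
    then show "v \<in> orb -` leaf k s \<longleftrightarrow> v \<in> lev k -` ((\<lambda>r. s + r) ` \<int>)"
      by (simp add: orb_in_leaf)
  qed
  moreover have "closed ((\<lambda>r. s + r) ` (\<int> :: real set))"
    by (intro closed_translation closed_Ints)
  then have "closed (lev k -` ((\<lambda>r. s + r) ` \<int>))"
    by (rule closed_vimage) (rule linear_continuous_on[OF bounded_linear_lev])
  ultimately show ?thesis
    using leaf_subset by (simp add: closedin_X topspace_X)
qed

lemma linear_lev: "linear (lev k)"
  by (rule bounded_linear.linear[OF bounded_linear_lev])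

lemma convex_hyp: "convex (hyp k s)"
proof -
  have "hyp k s = lev k -` {s}" by (auto simp: hyp_def)
  then show ?thesis using convex_linear_vimage[OF linear_lev] by simp
qed

lemma connectedin_leaf: "connectedin X (leaf k s)"
  unfolding leaf_def
  by (rule connectedin_continuous_map_image[OF continuous_map_orb]) (simp add: convex_hyp convex_connected)

section \<open>Level sets and their components\<close>

lemma level_set_eq:
  "{P \<in> topspace X. F k P = cos (2 * pi * s)} = leaf k s \<union> leaf k (- s)"
proof -
  have "F k (orb v) = cos (2 * pi * s) \<longleftrightarrow> lev k v - s \<in> \<int> \<or> lev k v + s \<in> \<int>" for v
  proof -
    have "2 * pi * a = 2 * pi * b + 2 * n * pi \<longleftrightarrow> a - b = n" for a b n
    proof -
      have "2 * pi * a = 2 * pi * b + 2 * n * pi \<longleftrightarrow> (2 * pi) * (a - b) = (2 * pi) * n"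
        by (simp add: algebra_simps)
      then show ?thesis by simp
    qed
    from this[of "lev k v" s] this[of "lev k v" "- s"] show ?thesis
      unfolding F_orb cos_eq by auto
  qed
  then have key: "F k (orb v) = cos (2 * pi * s) \<longleftrightarrow> orb v \<in> leaf k s \<union> leaf k (- s)" for v
    by (simp add: orb_in_leaf)
  have "P \<in> topspace X \<and> F k P = cos (2 * pi * s) \<longleftrightarrow> P \<in> leaf k s \<union> leaf k (- s)" for P
  proof (cases "P \<in> topspace X")
    case True
    then obtain v where "P = orb v" by (auto simp: topspace_X)
    with True key show ?thesis by simp
  next
    case False
    then show ?thesis using leaf_subset by blast
  qed
  then show ?thesis by blast
qed

text \<open>The level set is the union of two closed connected leaves, which coincide or are
  disjoint. Each is therefore clopen in it, and so a component.\<close>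

lemma component_eq_leaf:
  assumes C: "C \<in> connected_components_of (subtopology X {P \<in> topspace X. F k P = cos (2 * pi * s)})"
    (is "C \<in> connected_components_of ?Y")
    and meet: "\<not> disjnt C (leaf k s)"
  shows "C = leaf k s"
proof
  let ?L = "leaf k s" and ?L' = "leaf k (- s)"
  have Y: "topspace ?Y = ?L \<union> ?L'"
    using leaf_subset by (simp add: level_set_eq) blast
  have cl: "closedin ?Y ?L" "closedin ?Y ?L'"
    by (auto simp: level_set_eq closedin_subset_topspace closedin_leaf)
  \<comment> \<open>At a common point the two integrality conditions differ by \<open>2 * s\<close>,
    so \<open>s\<close> and \<open>- s\<close> agree modulo the integers.\<close>
  have "?L' \<subseteq> ?L" if "?L \<inter> ?L' \<noteq> {}"
  proof -
    obtain v where v: "orb v \<in> ?L" "orb v \<in> ?L'" using \<open>?L \<inter> ?L' \<noteq> {}\<close> leaf_subset[of k s] by (auto simp: topspace_X)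
    then have "(lev k v - - s) - (lev k v - s) \<in> \<int>"
      using Ints_diff[of "lev k v - - s" "lev k v - s"] by (simp only: orb_in_leaf)
    then have "leaf k s = leaf k (- s)" by (intro leaf_cong) simp
    then show ?thesis by simp
  qed
  then consider "?L \<union> ?L' - ?L = {}" | "?L \<union> ?L' - ?L = ?L'" by blast
  then have "closedin ?Y (topspace ?Y - ?L)"
  proof cases
    case 1
    show ?thesis unfolding Y 1 by simp
  next
    case 2
    show ?thesis unfolding Y 2 by (fact cl)
  qed
  then have "openin ?Y ?L"
    unfolding openin_closedin_eq using closedin_subset[OF cl(1)] by blast
  then show "C \<subseteq> ?L"
    using connectedin_clopen_cases[OF connectedin_connected_components_of[OF C] cl(1)] meet by blast
  have "connectedin ?Y ?L"
    by (simp add: connectedin_subtopology connectedin_leaf level_set_eq)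
  then show "?L \<subseteq> C"
    using connected_components_of_maximal[OF C] meet by blast
qed

lemma leaf_nonempty: "orb (axis y s) \<in> leaf k s"
  by (simp add: orb_in_leaf) (simp add: lev_def axis_def)

text \<open>The critical levels are included: there \<open>2 * s\<close> is an integer, the leaves
  for \<open>s\<close> and \<open>- s\<close> coincide, and the level set is a single leaf of the
  same kind as the others.\<close>

lemma level_components_F: "level_components X (F k) = range (leaf k)"
proof (intro set_eqI iffI)
  fix C assume "C \<in> level_components X (F k)"
  then obtain P where P: "P \<in> topspace X"
    and C: "C \<in> connected_components_of (subtopology X {Q \<in> topspace X. F k Q = F k P})"
    by (auto simp: level_components_def)
  have "C \<noteq> {}" using C nonempty_connected_components_of by blast
  then obtain Q where Q: "Q \<in> C" by blast
  then have "Q \<in> topspace X" "F k Q = F k P"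
    using connected_components_of_subset[OF C] by auto
  moreover obtain v where v: "Q = orb v" using \<open>Q \<in> topspace X\<close> by (auto simp: topspace_X)
  ultimately have "F k P = cos (2 * pi * lev k v)" by (simp add: F_orb)
  moreover have "\<not> disjnt C (leaf k (lev k v))"
    using Q v by (auto simp: disjnt_iff orb_in_leaf)
  ultimately have "C = leaf k (lev k v)" using component_eq_leaf C by simp
  then show "C \<in> range (leaf k)" by simp
next
  fix C assume "C \<in> range (leaf k)"
  then obtain s where s: "C = leaf k s" by blast
  let ?v = "axis y s :: real^'n"
  let ?Y = "subtopology X {P \<in> topspace X. F k P = cos (2 * pi * s)}"
  have F: "F k (orb ?v) = cos (2 * pi * s)" by (simp add: F_orb) (simp add: lev_def axis_def)
  then have Y: "orb ?v \<in> topspace ?Y" by (simp add: topspace_X)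
  let ?K = "connected_component_of_set ?Y (orb ?v)"
  have K: "?K \<in> connected_components_of ?Y"
    using Y by (rule connected_component_in_connected_components_of[THEN iffD2])
  have "orb ?v \<in> ?K" using Y by (simp add: connected_component_of_refl)
  then have "\<not> disjnt ?K (leaf k s)" using leaf_nonempty by (auto simp: disjnt_iff)
  then have "?K = leaf k s" by (rule component_eq_leaf[OF K])
  then have "leaf k s \<in> connected_components_of ?Y" using K by simp
  moreover have "cos (2 * pi * s) \<in> F k ` topspace X"
    using F by (metis imageI rangeI topspace_X)
  ultimately show "C \<in> level_components X (F k)"
    unfolding level_components_def s by blast
qed

section \<open>Leaves as embedded submanifolds\<close>

lemma subspace_hyp: "subspace (hyp k 0)"
  using linear_lev[of k] by (auto simp: hyp_def subspace_def linear_0 linear_add linear_scale)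

lemma embedded_leaf: "embedded_submanifold (dim (hyp k 0)) X A (leaf k s)"
  unfolding embedded_submanifold_def
proof (intro conjI ballI leaf_subset)
  fix p assume "p \<in> leaf k s"
  then obtain v where v: "lev k v = s" "p = orb v" by (auto simp: leaf_def hyp_def)
  \<comment> \<open>The ball makes \<open>orb\<close> injective. The bound on \<open>lev k\<close>
    keeps out the other sheets of the same leaf, whose levels differ from \<open>s\<close> by
    nonzero integers and which come close to \<open>v\<close> when \<open>k\<close> is
    large.\<close>
  define B where "B = ball v (1/2) \<inter> {w. \<bar>lev k w - s\<bar> < 1}"
  have inj: "inj_on orb B" by (rule inj_on_orb[of _ v]) (simp add: B_def)
  have "open {w. \<bar>lev k w - s\<bar> < 1}"
    by (intro open_Collect_less continuous_intros linear_continuous_on bounded_linear_lev)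
  then have B: "open B" by (simp add: B_def open_Int)
  have vB: "v \<in> B" by (simp add: B_def v)
  let ?\<phi> = "\<lambda>P. inv_into B orb P - v"
  have BL: "orb w \<in> leaf k s \<longleftrightarrow> lev k w = s" if "w \<in> B" for w
  proof
    assume "orb w \<in> leaf k s"
    then have "lev k w - s = 0" using that by (intro int_small) (auto simp: orb_in_leaf B_def)
    then show "lev k w = s" by simp
  qed (simp add: orb_in_leaf)
  have diff: "lev k (w - v) = lev k w - s" for w
    using linear_diff[OF linear_lev] v by simp
  show "\<exists>U \<phi> V. is_chart X (U, \<phi>) \<and> (\<forall>c\<in>A. compatible_charts c (U, \<phi>)) \<and> p \<in> U \<and>
        subspace V \<and> dim V = dim (hyp k 0) \<and> \<phi> ` (U \<inter> leaf k s) = \<phi> ` U \<inter> V"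
  proof (intro exI conjI)
    show "is_chart X (orb ` B, ?\<phi>)"
      using is_chart_chart[OF B inj, of v] by (simp add: chart_def)
    show "\<forall>c\<in>A. compatible_charts c (orb ` B, ?\<phi>)"
      using compatible_charts_chart[OF _ _ B inj, of _ _ v] A_cases
      unfolding chart_def[of B v, symmetric] by metis
    show "p \<in> orb ` B" using v vB by simp
    show "?\<phi> ` (orb ` B \<inter> leaf k s) = ?\<phi> ` orb ` B \<inter> hyp k 0"
    proof (intro set_eqI iffI)
      fix u assume "u \<in> ?\<phi> ` (orb ` B \<inter> leaf k s)"
      then obtain w where "w \<in> B" "orb w \<in> leaf k s" "u = w - v" using inj by auto
      then show "u \<in> ?\<phi> ` orb ` B \<inter> hyp k 0"
        by (auto simp: chart_image[OF inj] BL hyp_def diff)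
    next
      fix u assume "u \<in> ?\<phi> ` orb ` B \<inter> hyp k 0"
      then obtain w where "w \<in> B" "u = w - v" "lev k w = s"
        by (auto simp: chart_image[OF inj] hyp_def diff)
      then show "u \<in> ?\<phi> ` (orb ` B \<inter> leaf k s)"
        using BL inj by (intro image_eqI[of _ _ "orb w"]) auto
    qed
  qed (rule subspace_hyp, rule refl)
qed

section \<open>The flow along \<open>t\<close>\<close>

definition shift :: "real \<Rightarrow> (real^'n) set \<Rightarrow> (real^'n) set" where
  "shift r P = (\<lambda>v. v + axis t r) ` P"

text \<open>Translations along \<open>t\<close> are central in the group, so they descend to the
  quotient.\<close>

lemma mul_shift: "mul m (v + axis t r) = mul m v + axis t r"
  by (simp add: vec_eq_iff mul_nth axis_def)

lemma shift_orb: "shift r (orb v) = orb (v + axis t r)"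
  by (simp add: shift_def orb_def image_image mul_shift)

lemma shift_shift: "shift r (shift s P) = shift (s + r) P"
proof -
  have "axis t s + axis t r = (axis t (s + r) :: real^'n)" by (simp add: axis_def vec_eq_iff)
  then show ?thesis by (simp add: shift_def image_image add.assoc)
qed

lemma shift_0 [simp]: "shift 0 P = P"
  by (simp add: shift_def axis_eq_0_iff[THEN iffD2])

lemma continuous_map_shift: "continuous_map X X (shift r)"
proof -
  have "orb -` {P \<in> topspace X. shift r P \<in> U} = (\<lambda>v. v + axis t r) -` (orb -` U)" for U
    by (auto simp: topspace_X shift_orb)
  then show ?thesis
    by (auto simp: continuous_map_def openin_X topspace_X shift_orb intro!: open_vimage continuous_intros)
qed

text \<open>In charts the flow is a local inverse of \<open>orb\<close> applied to
  \<open>orb (v + axis t r)\<close>, an instance of \<open>smooth_on_inv_into_orb\<close>.\<close>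

lemma smooth_shift: "smooth_map_on_open X A (topspace X) (shift r)"
  unfolding smooth_map_on_open_def
proof (intro conjI ballI case_prodI2)
  show "continuous_map (subtopology X (topspace X)) X (shift r)"
    by (simp add: continuous_map_shift)
  fix c U \<phi> d V \<psi>
  assume "c \<in> A" "c = (U, \<phi>)" "d \<in> A" "d = (V, \<psi>)"
  then obtain B C where B: "open B" "inj_on orb B" and cU: "(U, \<phi>) = chart B 0"
     and C: "open C" "inj_on orb C" and cV: "(V, \<psi>) = chart C 0" by (metis A_cases)
  have U: "U = orb ` B" "\<phi> = inv_into B orb" and V: "V = orb ` C" "\<psi> = inv_into C orb"
    using cU cV by (auto simp: chart_def)
  define Q where "Q = {q \<in> U \<inter> topspace X. shift r q \<in> V}"
  have Q: "Q = {q \<in> orb ` B. shift r q \<in> orb ` C}"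
    by (auto simp: Q_def U V topspace_X)
  have S: "\<phi> ` Q = {v \<in> B. orb (v + axis t r) \<in> orb ` C}"
  proof (intro set_eqI iffI)
    fix v assume "v \<in> \<phi> ` Q"
    then obtain w where "w \<in> B" "shift r (orb w) \<in> orb ` C" "v = inv_into B orb (orb w)"
      by (auto simp: Q U)
    then show "v \<in> {v \<in> B. orb (v + axis t r) \<in> orb ` C}"
      using B by (simp add: shift_orb)
  next
    fix v assume "v \<in> {v \<in> B. orb (v + axis t r) \<in> orb ` C}"
    then show "v \<in> \<phi> ` Q"
      using B by (intro image_eqI[of _ _ "orb v"]) (auto simp: Q U shift_orb)
  qed
  have "\<phi> ` Q = B \<inter> (\<lambda>v. v + axis t r) -` (orb -` orb ` C)" unfolding S by auto
  moreover have "open \<dots>"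
    using openin_orb_image[OF C(1)] B(1)
    by (intro open_Int open_vimage continuous_intros) (auto simp: openin_X)
  ultimately have oS: "open (\<phi> ` Q)" by simp
  have "smooth_on (\<phi> ` Q) (\<lambda>v. inv_into C orb (orb (v + axis t r)) + 0)"
    by (rule smooth_on_inv_into_orb[OF C]) (simp add: S)
  then have "smooth_on (\<phi> ` Q) (\<psi> \<circ> shift r \<circ> inv_into U \<phi>)"
  proof (rule smooth_on_eq[OF _ oS])
    fix v assume "v \<in> \<phi> ` Q"
    then have "v \<in> B" by (simp add: S)
    then show "(\<psi> \<circ> shift r \<circ> inv_into U \<phi>) v = inv_into C orb (orb (v + axis t r)) + 0"
      using inv_into_chart[OF B(2), of v 0] by (simp add: U V shift_orb)
  qed
  then show "smooth_on (\<phi> ` {q \<in> U \<inter> topspace X. shift r q \<in> V}) (\<psi> \<circ> shift r \<circ> inv_into U \<phi>)"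
    by (simp add: Q_def)
qed simp

lemma shift_leaf: "shift r ` leaf k s = leaf k (s + real k * r)"
proof (intro set_eqI iffI)
  have lev: "lev k (v + axis t r) = lev k v + real k * r" for v and r
    by (simp add: lev_def axis_def algebra_simps)
  fix P
  show "P \<in> leaf k (s + real k * r)" if "P \<in> shift r ` leaf k s"
    using that by (auto simp: leaf_def hyp_def shift_orb lev)
  assume "P \<in> leaf k (s + real k * r)"
  then obtain v where v: "P = orb v" "lev k v = s + real k * r" by (auto simp: leaf_def hyp_def)
  show "P \<in> shift r ` leaf k s"
  proof (rule image_eqI)
    show "P = shift r (shift (- r) P)" by (simp add: shift_shift)
    show "shift (- r) P \<in> leaf k s"
      using v lev[of v "- r"] by (auto simp: leaf_def hyp_def shift_orb)
  qed
qed

lemma diffeomorphic_leaves: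
  assumes "k > 0"
  shows "diffeomorphic_submanifolds X A (leaf k s) (leaf k s')"
proof -
  \<comment> \<open>Flowing for time \<open>r\<close> raises \<open>lev k\<close> by
    \<open>real k * r\<close>; positivity of \<open>k\<close> makes every level reachable.\<close>
  define r where "r = (s' - s) / real k"
  have im: "shift r ` leaf k s = leaf k s'"
    using assms by (simp add: shift_leaf r_def)
  have im': "shift (- r) ` leaf k s' = leaf k s"
    using assms by (simp add: shift_leaf r_def)
  have inj: "inj_on (shift r) (leaf k s)"
    by (rule inj_on_inverseI[of _ "shift (- r)"]) (simp add: shift_shift)
  have inv: "inv_into (leaf k s) (shift r) P = shift (- r) P" if "P \<in> leaf k s'" for P
    using that inj im im' by (intro inv_into_f_eq) (auto simp: shift_shift)
  have "smooth_map_between X A (leaf k s) (leaf k s') (shift r)"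
    unfolding smooth_map_between_def
    using im smooth_shift[of r] leaf_subset[of k s] by blast
  moreover have "smooth_map_between X A (leaf k s') (leaf k s) (inv_into (leaf k s) (shift r))"
    unfolding smooth_map_between_def
  proof (intro conjI ballI)
    show "inv_into (leaf k s) (shift r) ` leaf k s' \<subseteq> leaf k s"
      using im' inv by auto
    show "\<exists>W H. P \<in> W \<and> smooth_map_on_open X A W H \<and>
        (\<forall>Q\<in>leaf k s' \<inter> W. H Q = inv_into (leaf k s) (shift r) Q)" if "P \<in> leaf k s'" for P
      using smooth_shift[of "- r"] leaf_subset[of k s'] inv that
      by (intro exI[of _ "topspace X"] exI[of _ "shift (- r)"]) auto
  qed
  ultimately show ?thesis
    unfolding diffeomorphic_submanifolds_def
    using embedded_leaf inj im by (auto simp: bij_betw_def)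
qed

section \<open>Topological distinction of the leaves\<close>

text \<open>A continuous injection of a compact space into a Hausdorff space is a homeomorphism onto
  its image, and \<open>orb\<close> is open.\<close>

lemma openin_emb_image:
  assumes "open S"
  shows "openin (top_of_set (range emb)) (emb ` S)"
proof -
  have im: "(emb \<circ> rep) ` orb ` S = emb ` S" for S
    by (simp add: image_image)
  have "homeomorphic_map X (top_of_set (range emb)) (emb \<circ> rep)"
  proof (rule continuous_imp_homeomorphic_map)
    show "continuous_map X (top_of_set (range emb)) (emb \<circ> rep)"
      using continuous_map_emb by (auto simp: continuous_map_in_subtopology)
    show "(emb \<circ> rep) ` topspace X = topspace (top_of_set (range emb))"
      using im[of UNIV] by (simp add: topspace_X)
  qed (simp_all add: compact_X inj_on_emb Hausdorff_space_subtopology)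
  then have "open_map X (top_of_set (range emb)) (emb \<circ> rep)"
    by (rule homeomorphic_imp_open_map)
  then show ?thesis
    using openin_orb_image[OF assms] im[of S] unfolding open_map_def by metis
qed

text \<open>Images of balls of radius 1/2 are evenly covered. The sheets are the lattice translates
  of the ball, disjoint because \<open>orb\<close> is injective on it and the action is
  free.\<close>

lemma covering_space_emb: "covering_space UNIV emb (range emb)"
proof
  fix p assume "p \<in> range emb"
  then obtain u where u: "p = emb u" by blast
  let ?B = "ball u (1/2)"
  have inj: "inj_on orb ?B" by (rule inj_on_orb[of _ u]) simp
  let ?T = "emb ` ?B" and ?v = "(\<lambda>m. mul m ` ?B) ` \<Gamma>"
  show "\<exists>T. p \<in> T \<and> openin (top_of_set (range emb)) T \<and>
     (\<exists>v. \<Union>v = UNIV \<inter> emb -` T \<and> (\<forall>u\<in>v. openin (top_of_set UNIV) u) \<and>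
        pairwise disjnt v \<and> (\<forall>u\<in>v. \<exists>q. homeomorphism u T emb q))"
  proof (intro exI[of _ ?T] exI[of _ ?v] conjI)
    show "p \<in> ?T" using u by simp
    show "openin (top_of_set (range emb)) ?T" by (rule openin_emb_image) simp
    have "w \<in> emb -` ?T \<longleftrightarrow> w \<in> orb -` orb ` ?B" for w
      unfolding vimage_eq image_iff emb_eq_iff ..
    then have "emb -` ?T = orb -` orb ` ?B" by (rule set_eqI)
    then show "\<Union>?v = UNIV \<inter> emb -` ?T" by (simp add: vimage_orb_image)
    show "\<forall>u\<in>?v. openin (top_of_set UNIV) u" by (auto intro: open_mul_image)
    show "pairwise disjnt ?v"
    proof (rule pairwiseI)
      fix S S' assume SS: "S \<in> ?v" "S' \<in> ?v" "S \<noteq> S'"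
      then obtain m m' where m: "m \<in> \<Gamma>" "S = mul m ` ?B" "m' \<in> \<Gamma>" "S' = mul m' ` ?B" by blast
      show "disjnt S S'"
      proof (rule ccontr)
        assume "\<not> disjnt S S'"
        then obtain b b' where b: "b \<in> ?B" "b' \<in> ?B" "mul m b = mul m' b'"
          by (auto simp: m disjnt_iff)
        then have "orb b = orb b'" by (metis orb_mul m(1,3))
        then have "b = b'" using inj b(1,2) by (auto dest: inj_onD)
        then have "m = m'" using b(3) by simp
        then show False using SS(3) m by simp
      qed
    qed
    show "\<forall>u\<in>?v. \<exists>q. homeomorphism u ?T emb q"
    proof
      fix S assume "S \<in> ?v"
      then obtain m where m: "m \<in> \<Gamma>" and S: "S = mul m ` ?B" by blast
      have emb_m: "emb (mul m b) = emb b" for b using m by (simp add: emb_eq_iff orb_mul)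
      have oS: "open S" unfolding S by (rule open_mul_image) simp
      have "\<exists>g. homeomorphism S ?T emb g"
      proof (rule homeomorphism_injective_open_map)
        show "continuous_on S emb" using continuous_on_emb continuous_on_subset by blast
        show im: "emb ` S = ?T" by (simp add: S image_image emb_m)
        show "inj_on emb S"
        proof (rule inj_onI)
          fix p q assume pq: "p \<in> S" "q \<in> S" "emb p = emb q"
          then obtain b b' where b: "b \<in> ?B" "b' \<in> ?B" "p = mul m b" "q = mul m b'"
            unfolding S by blast
          then have "orb b = orb b'" using pq(3) emb_m emb_eq_iff by metis
          then have "b = b'" using inj_onD[OF inj] b by blast
          then show "p = q" using b by simp
        qed
        show "openin (top_of_set ?T) (emb ` W)" if "openin (top_of_set S) W" for W
        proof (rule openin_subset_trans)
          show "openin (top_of_set (range emb)) (emb ` W)"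
            using that oS openin_open_trans by (intro openin_emb_image) blast
          show "emb ` W \<subseteq> ?T" using im openin_imp_subset[OF that] by blast
        qed auto
      qed blast
      then show "\<exists>q. homeomorphism S ?T emb q" .
    qed
  qed
qed (auto simp: continuous_on_emb)

section \<open>Lifting maps through the covering\<close>

lemma lift_orb:
  fixes U :: "(real^'n) set"
  assumes U: "convex U" "a \<in> U" and f: "continuous_map (top_of_set U) X f" and b: "f a = orb b"
  obtains h where "continuous_on U h" "h a = b" "\<And>v. v \<in> U \<Longrightarrow> orb (h v) = f v"
proof -
  \<comment> \<open>The map is pushed into the normed space, where lifting applies because a convex
    \<open>U\<close> is simply connected and locally path connected.\<close>
  have "continuous_map (top_of_set U) euclidean ((emb \<circ> rep) \<circ> f)"
    using f continuous_map_emb by (rule continuous_map_compose)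
  then have cont: "continuous_on U ((emb \<circ> rep) \<circ> f)" by simp
  obtain h where h: "continuous_on U h" "h a = b" "\<And>v. v \<in> U \<Longrightarrow> emb (h v) = ((emb \<circ> rep) \<circ> f) v"
  proof (rule covering_space_lift_strong[OF covering_space_emb _ U(2) _ _ cont])
    show "simply_connected U" "locally path_connected U"
      using U(1) by (auto intro: convex_imp_simply_connected convex_imp_locally_path_connected)
    show "((emb \<circ> rep) \<circ> f) a = emb b" by (simp add: b)
  qed auto
  have "orb (h v) = f v" if "v \<in> U" for v
  proof -
    have "f v \<in> range orb"
      using continuous_map_image_subset_topspace[OF f] that by (auto simp: topspace_X)
    then show ?thesis using h(3)[OF that] by (simp add: emb_eq_iff orb_rep)
  qed
  with h show ?thesis using that by blast
qed

lemma lift_orb_unique: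
  assumes "connected U" "a \<in> U" "v \<in> U" "continuous_on U h1" "continuous_on U h2"
    "\<And>w. w \<in> U \<Longrightarrow> orb (h1 w) = orb (h2 w)" "h1 a = h2 a"
  shows "h1 v = h2 v"
proof (rule covering_space_lift_unique[OF covering_space_emb, where f = "emb \<circ> h1" and T = U and a = a])
  show "continuous_on U (emb \<circ> h1)"
    by (intro continuous_on_compose assms continuous_on_subset[OF continuous_on_emb]) simp
qed (use assms in \<open>auto simp: emb_eq_iff\<close>)

section \<open>Deck groups of the leaves, and lifts between hyperplanes\<close>

definition stab :: "nat \<Rightarrow> (real^'n) set" where
  "stab k = {m \<in> \<Gamma>. lev k m = 0}"

text \<open>Thus \<open>stab k\<close> acts on each hyperplane as the deck group of the covering of
  its leaf.\<close>

lemma mul_hyp: "m \<in> stab k \<Longrightarrow> v \<in> hyp k s \<Longrightarrow> mul m v \<in> hyp k s"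
  by (simp add: stab_def hyp_def lev_mul)

text \<open>A lift could a priori land on any level in \<open>s' + \<int>\<close>. The level along
  the lift is continuous and discrete on a connected set, hence constant, and its value at
  \<open>a\<close> is \<open>s'\<close>.\<close>

lemma lift_leaf_map:
  assumes f: "continuous_map (subtopology X (leaf k s)) (subtopology X (leaf k' s')) f"
    and a: "a \<in> hyp k s" and b: "b \<in> hyp k' s'" and ab: "f (orb a) = orb b"
  obtains h where "continuous_on (hyp k s) h" "h a = b" "h \<in> hyp k s \<rightarrow> hyp k' s'"
    "\<And>v. v \<in> hyp k s \<Longrightarrow> orb (h v) = f (orb v)"
proof -
  have "continuous_map (top_of_set (hyp k s)) (subtopology X (leaf k s)) orb"
    using continuous_map_orb
    by (auto simp: continuous_map_in_subtopology leaf_def intro: continuous_map_from_subtopology)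
  from continuous_map_compose[OF this f] have "continuous_map (top_of_set (hyp k s)) X (f \<circ> orb)"
    by (simp add: continuous_map_in_subtopology)
  then obtain h where h: "continuous_on (hyp k s) h" "h a = b"
      "\<And>v. v \<in> hyp k s \<Longrightarrow> orb (h v) = f (orb v)"
    using lift_orb[OF convex_hyp a, of "f \<circ> orb" b] ab by auto
  have int: "lev k' (h v) - s' \<in> \<int>" if "v \<in> hyp k s" for v
  proof -
    have "orb v \<in> topspace (subtopology X (leaf k s))"
      using that leaf_subset by (auto simp: leaf_def topspace_X)
    then have "f (orb v) \<in> topspace (subtopology X (leaf k' s'))"
      using continuous_map_image_subset_topspace[OF f] by blast
    then have "orb (h v) \<in> leaf k' s'" using h(3)[OF that] by simp
    then show ?thesis by (simp add: orb_in_leaf)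
  qed
  have "(\<lambda>v. lev k' (h v) - s') constant_on hyp k s"
  proof (rule continuous_discrete_range_constant)
    show "connected (hyp k s)" by (simp add: convex_hyp convex_connected)
    show "continuous_on (hyp k s) (\<lambda>v. lev k' (h v) - s')"
      by (intro continuous_intros bounded_linear.continuous_on[OF bounded_linear_lev] h)
    fix v assume v: "v \<in> hyp k s"
    show "\<exists>e>0. \<forall>w. w \<in> hyp k s \<and> lev k' (h w) - s' \<noteq> lev k' (h v) - s'
        \<longrightarrow> e \<le> norm (lev k' (h w) - s' - (lev k' (h v) - s'))"
    proof (intro exI[of _ 1] conjI allI impI)
      fix w assume w: "w \<in> hyp k s \<and> lev k' (h w) - s' \<noteq> lev k' (h v) - s'"
      then have "lev k' (h w) - s' - (lev k' (h v) - s') \<in> \<int>"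
        by (intro Ints_diff[OF int int]) (use v in auto)
      then show "1 \<le> norm (lev k' (h w) - s' - (lev k' (h v) - s'))"
        using int_small[of "lev k' (h w) - s' - (lev k' (h v) - s')"] w by force
    qed simp
  qed
  then obtain c where c: "\<And>v. v \<in> hyp k s \<Longrightarrow> lev k' (h v) - s' = c"
    unfolding constant_on_def by blast
  have "c = 0" using c[OF a] b h(2) by (simp add: hyp_def)
  then have "lev k' (h v) = s'" if "v \<in> hyp k s" for v
    using c[OF that] by simp
  then have "h \<in> hyp k s \<rightarrow> hyp k' s'" by (auto simp: hyp_def)
  with h that show ?thesis by blast
qed

text \<open>The graph of the homomorphism of deck groups induced by the lift \<open>h\<close>. As a
  relation it involves no choice of \<open>m'\<close>.\<close>

definition equivariant ::
    "nat \<Rightarrow> nat \<Rightarrow> real \<Rightarrow> (real^'n \<Rightarrow> real^'n) \<Rightarrow> real^'n \<Rightarrow> real^'n \<Rightarrow> bool" where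
  "equivariant k k' s h m m' \<longleftrightarrow>
     m \<in> stab k \<and> m' \<in> stab k' \<and> (\<forall>v\<in>hyp k s. h (mul m v) = mul m' (h v))"

text \<open>Choose \<open>m'\<close> at the base point \<open>a\<close>. Then \<open>h\<close> after
  \<open>m\<close> and \<open>m'\<close> after \<open>h\<close> lift the same map and agree at
  \<open>a\<close>, so they agree everywhere. As \<open>h\<close> takes values in one hyperplane,
  \<open>m'\<close> preserves levels.\<close>

lemma equivariant_exists:
  assumes h: "continuous_on (hyp k s) h" "h \<in> hyp k s \<rightarrow> hyp k' s'"
      "\<And>v. v \<in> hyp k s \<Longrightarrow> orb (h v) = f (orb v)"
    and a: "a \<in> hyp k s" and m: "m \<in> stab k"
  shows "\<exists>m'. equivariant k k' s h m m'"
proof -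
  have m\<Gamma>: "m \<in> \<Gamma>" using m by (simp add: stab_def)
  note hyp = mul_hyp[OF m]
  have orb: "orb (h (mul m v)) = orb (h v)" if "v \<in> hyp k s" for v
    using that hyp by (simp add: h(3) orb_mul[OF m\<Gamma>])
  from orb[OF a, symmetric] obtain m' where m': "m' \<in> \<Gamma>" "h (mul m a) = mul m' (h a)"
    by (auto simp: orb_eq_iff)
  have "lev k' (h (mul m a)) = lev k' (h a)"
    using h(2) a hyp[OF a] by (auto simp: hyp_def Pi_iff)
  then have "m' \<in> stab k'" using m' by (simp add: stab_def lev_mul)
  moreover have "h (mul m v) = mul m' (h v)" if v: "v \<in> hyp k s" for v
  proof (rule lift_orb_unique[OF _ a v])
    show "connected (hyp k s)" by (simp add: convex_hyp convex_connected)
    show "continuous_on (hyp k s) (\<lambda>v. h (mul m v))"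
      by (rule continuous_on_compose2[OF h(1)]) (auto intro: continuous_intros hyp)
    show "continuous_on (hyp k s) (\<lambda>v. mul m' (h v))"
      by (intro continuous_intros h)
  qed (auto simp: orb orb_mul m')
  ultimately show ?thesis using m by (auto simp: equivariant_def)
qed

lemma stab_mul: "m \<in> stab k \<Longrightarrow> m' \<in> stab k \<Longrightarrow> mul m m' \<in> stab k"
  by (simp add: stab_def lev_mul \<Gamma>_mul)

lemma equivariant_mul:
  assumes "equivariant k k' s h a a'" "equivariant k k' s h b b'"
  shows "equivariant k k' s h (mul a b) (mul a' b')"
  using assms by (auto simp: equivariant_def stab_mul mul_assoc mul_hyp)

lemma lev_0: "lev k 0 = 0"
  by (simp add: lev_def)

text \<open>\<open>(mul u ^^ d) 0\<close> is the power of \<open>u\<close> with exponent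
  \<open>d\<close>, starting from the neutral element 0.\<close>

lemma equivariant_power:
  assumes "equivariant k k' s h u u'"
  shows "equivariant k k' s h ((mul u ^^ d) 0) ((mul u' ^^ d) 0)"
proof (induction d)
  case 0
  show ?case by (simp add: equivariant_def stab_def lev_0)
next
  case (Suc d)
  then show ?case by (simp add: equivariant_mul[OF assms])
qed

text \<open>
  That all commutators of \<open>stab k\<close> are \<open>d\<close>-th powers, written without inverses.
\<close>

definition power_commutators :: "nat \<Rightarrow> nat \<Rightarrow> bool" where
  "power_commutators d k \<longleftrightarrow>
     (\<forall>a\<in>stab k. \<forall>b\<in>stab k. \<exists>u\<in>stab k. mul a b = mul ((mul u ^^ d) 0) (mul b a))"

text \<open>The homeomorphism and its inverse lift to mutually inverse maps of the hyperplanes.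
  Conjugation by them is an isomorphism of the deck groups, which carries the condition on
  commutators across.\<close>

lemma homeomorphic_leaves_power_commutators:
  assumes "subtopology X (leaf k s) homeomorphic_space subtopology X (leaf k' s')"
    and P: "power_commutators d k"
  shows "power_commutators d k'"
proof -
  obtain f e where fe: "homeomorphic_maps (subtopology X (leaf k s)) (subtopology X (leaf k' s')) f e"
    using assms(1) by (auto simp: homeomorphic_space_def)
  have top: "topspace (subtopology X (leaf k s)) = leaf k s" for k s
    using leaf_subset by auto
  have f: "continuous_map (subtopology X (leaf k s)) (subtopology X (leaf k' s')) f"
    and e: "continuous_map (subtopology X (leaf k' s')) (subtopology X (leaf k s)) e"
    and ef: "\<And>p. p \<in> leaf k s \<Longrightarrow> e (f p) = p" and fe: "\<And>p. p \<in> leaf k' s' \<Longrightarrow> f (e p) = p"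
    using fe unfolding homeomorphic_maps_def top by auto
  have leafI: "orb v \<in> leaf k s" if "v \<in> hyp k s" for v k s
    using that by (simp add: leaf_def)
  obtain a where a: "a \<in> hyp k s" using leaf_nonempty[of s k] by (auto simp: leaf_def)
  have "f (orb a) \<in> leaf k' s'"
    using continuous_map_image_subset_topspace[OF f] leafI[OF a] unfolding top by blast
  then obtain b where b: "b \<in> hyp k' s'" "f (orb a) = orb b" by (auto simp: leaf_def)
  obtain h where h: "continuous_on (hyp k s) h" "h a = b" "h \<in> hyp k s \<rightarrow> hyp k' s'"
      "\<And>v. v \<in> hyp k s \<Longrightarrow> orb (h v) = f (orb v)"
    using lift_leaf_map[OF f a b] by blast
  \<comment> \<open>With base points matched in this way, both composites of the lifts fix a point,
    and uniqueness of lifts makes them identities.\<close>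
  have "e (orb b) = orb a" using ef[OF leafI[OF a]] b by simp
  then obtain h' where h': "continuous_on (hyp k' s') h'" "h' b = a" "h' \<in> hyp k' s' \<rightarrow> hyp k s"
      "\<And>v. v \<in> hyp k' s' \<Longrightarrow> orb (h' v) = e (orb v)"
    using lift_leaf_map[OF e b(1) a] by blast
  have conn: "connected (hyp k s)" for k s by (simp add: convex_hyp convex_connected)
  have hh': "h (h' v) = v" if v: "v \<in> hyp k' s'" for v
  proof (rule lift_orb_unique[OF conn b(1) v])
    show "continuous_on (hyp k' s') (\<lambda>v. h (h' v))"
      by (rule continuous_on_compose2[OF h(1) h'(1)]) (use h'(3) in auto)
  qed (use h h' fe leafI in \<open>auto simp: Pi_iff\<close>)
  have h'h: "h' (h v) = v" if v: "v \<in> hyp k s" for v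
  proof (rule lift_orb_unique[OF conn a v])
    show "continuous_on (hyp k s) (\<lambda>v. h' (h v))"
      by (rule continuous_on_compose2[OF h'(1) h(1)]) (use h(3) in auto)
  qed (use h h' ef leafI in \<open>auto simp: Pi_iff\<close>)
  have total: "\<exists>m'. equivariant k k' s h m m'" if "m \<in> stab k" for m
    using equivariant_exists[OF h(1,3,4) a that] .
  \<comment> \<open>Equivariance of the inverse lift, read backwards.\<close>
  have onto: "\<exists>m. equivariant k k' s h m m'" if m': "m' \<in> stab k'" for m'
  proof -
    obtain m where m: "equivariant k' k s' h' m' m"
      using equivariant_exists[OF h'(1,3,4) b(1) m'] by blast
    have "h (mul m v) = mul m' (h v)" if v: "v \<in> hyp k s" for v
    proof -
      have hv: "h v \<in> hyp k' s'" using h(3) v by blast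
      then have "h' (mul m' (h v)) = mul m v"
        using m h'h[OF v] by (simp add: equivariant_def)
      then show ?thesis using hh'[OF mul_hyp[OF m' hv]] by simp
    qed
    then show ?thesis using m m' by (auto simp: equivariant_def)
  qed
  \<comment> \<open>The group acts freely, so the value at \<open>a\<close> determines the
    element.\<close>
  have unique: "m' = m''" if "equivariant k k' s h m m'" "equivariant k k' s h m m''" for m m' m''
    using that a mul_cancel_right[of m' "h a" m''] by (auto simp: equivariant_def)
  show ?thesis
    unfolding power_commutators_def
  proof (intro ballI)
    fix a' b' assume "a' \<in> stab k'" "b' \<in> stab k'"
    then obtain a b where ab: "equivariant k k' s h a a'" "equivariant k k' s h b b'"
      using onto by blast
    then have "a \<in> stab k" "b \<in> stab k" by (simp_all add: equivariant_def)
    then obtain u where u: "u \<in> stab k" "mul a b = mul ((mul u ^^ d) 0) (mul b a)"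
      using P unfolding power_commutators_def by blast
    then obtain u' where u': "equivariant k k' s h u u'" using total by blast
    have "equivariant k k' s h (mul a b) (mul a' b')"
      using ab by (rule equivariant_mul)
    \<comment> \<open>Both sides of the desired equation correspond to the single element
      \<open>mul a b\<close>, rewritten by the power condition in \<open>stab k\<close>.\<close>
    moreover have "equivariant k k' s h (mul a b) (mul ((mul u' ^^ d) 0) (mul b' a'))"
      unfolding u(2) by (intro equivariant_mul equivariant_power ab u')
    ultimately have "mul a' b' = mul ((mul u' ^^ d) 0) (mul b' a')" by (rule unique)
    then show "\<exists>u\<in>stab k'. mul a' b' = mul ((mul u ^^ d) 0) (mul b' a')"
      using u' by (auto simp: equivariant_def)
  qed
qed

section \<open>Powers and commutators in \<open>stab k\<close>\<close>

lemma power_nth: "i \<noteq> z \<Longrightarrow> (mul u ^^ d) 0 $ i = real d * u $ i"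
  by (induction d) (simp_all add: mul_nth algebra_simps)

lemma power_nth_z: "u $ x = 0 \<Longrightarrow> (mul u ^^ d) 0 $ z = real d * u $ z"
  by (induction d) (simp_all add: mul_nth algebra_simps)

lemma power_commutators_self: "power_commutators k k"
  unfolding power_commutators_def
proof (intro ballI)
  fix a b assume a: "a \<in> stab k" and b: "b \<in> stab k"
  then have y: "a $ y = - real k * a $ t" "b $ y = - real k * b $ t"
    by (auto simp: stab_def lev_def)
  \<comment> \<open>The commutator of \<open>a\<close> and \<open>b\<close> is
    \<open>axis z (a $ x * b $ y - b $ x * a $ y)\<close>. Substituting \<open>y\<close> by
    \<open>- real k\<close> times \<open>t\<close> exhibits it as \<open>k\<close> times this
    central element.\<close>
  define u :: "real^'n" where "u = axis z (b $ x * a $ t - a $ x * b $ t)"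
  have nth: "u $ i = (if i = z then b $ x * a $ t - a $ x * b $ t else 0)" for i
    by (simp add: u_def axis_def)
  have "u \<in> stab k"
    using a b by (simp add: stab_def lev_def \<Gamma>_def nth)
  moreover have "mul a b = mul ((mul u ^^ k) 0) (mul b a)"
    unfolding vec_eq_iff
  proof
    fix i
    show "mul a b $ i = mul ((mul u ^^ k) 0) (mul b a) $ i"
      by (cases "i = z") (simp_all add: mul_nth power_nth power_nth_z nth y algebra_simps)
  qed
  ultimately show "\<exists>u\<in>stab k. mul a b = mul ((mul u ^^ k) 0) (mul b a)" by blast
qed

lemma power_commutators_dvd:
  assumes "power_commutators d k" "d > 0"
  shows "d dvd k"
proof -
  \<comment> \<open>These two elements of \<open>stab k\<close> have commutator
    \<open>axis z (- real k)\<close>, so \<open>d\<close> must divide \<open>k\<close>.\<close>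
  define a b :: "real^'n" where "a = axis x 1" and "b = axis t 1 + axis y (- real k)"
  have nth: "a $ i = (if i = x then 1 else 0)"
      "b $ i = (if i = t then 1 else if i = y then - real k else 0)" for i
    by (auto simp: a_def b_def axis_def)
  have "a \<in> stab k" "b \<in> stab k"
    by (auto simp: stab_def lev_def \<Gamma>_def nth)
  then obtain u where u: "u \<in> stab k" "mul a b = mul ((mul u ^^ d) 0) (mul b a)"
    using assms(1) unfolding power_commutators_def by blast
  from u(2) have eq: "mul a b $ i = mul ((mul u ^^ d) 0) (mul b a) $ i" for i by simp
  \<comment> \<open>The commutator has \<open>x\<close> coordinate 0, so
    \<open>real d * u $ x = 0\<close>. This makes the \<open>z\<close> coordinate of the power
    exactly \<open>real d * u $ z\<close>.\<close>
  from eq[of x] have ux: "u $ x = 0"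
    using assms(2) by (simp add: mul_nth power_nth nth)
  from eq[of z] have "real d * u $ z = - real k"
    by (simp add: mul_nth power_nth power_nth_z nth ux)
  moreover obtain j where "u $ z = of_int j"
    using u(1) by (auto simp: stab_def \<Gamma>_def elim: Ints_cases)
  ultimately have "real_of_int (int d * j) = real_of_int (- int k)" by simp
  then have "int d * j = - int k" by (simp only: of_int_eq_iff)
  then have "int k = int d * (- j)" by simp
  then show ?thesis using dvd_triv_left[of "int d" "- j"] by (simp only: int_dvd_int_iff flip: \<open>int k = _\<close>)
qed

text \<open>Taking the exponent \<open>k\<close>, valid for \<open>stab k\<close>, across the
  homeomorphism gives that \<open>k\<close> divides \<open>k'\<close>; exchanging the leaves gives
  the converse.\<close>

lemma homeomorphic_leaves_imp_eq:
  assumes hom: "subtopology X (leaf k s) homeomorphic_space subtopology X (leaf k' s')"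
    and "k > 0" "k' > 0"
  shows "k = k'"
proof (rule dvd_antisym)
  show "k dvd k'"
    using homeomorphic_leaves_power_commutators[OF hom power_commutators_self] assms
    by (intro power_commutators_dvd) auto
  have "subtopology X (leaf k' s') homeomorphic_space subtopology X (leaf k s)"
    using hom homeomorphic_space_sym by blast
  then show "k' dvd k"
    using homeomorphic_leaves_power_commutators power_commutators_self assms
    by (intro power_commutators_dvd) auto
qed

end

theorem theorem1p6:
  assumes "CARD('n::finite) \<ge> 4"
  shows "\<exists>(X :: (real^'n) set topology) (A :: ((real^'n) set, 'n) chart set)
            (g :: ((real^'n) set, 'n) metric) (\<F> :: nat \<Rightarrow> (real^'n) set set set).
     closed_riemannian_manifold X A g \<and>
     (\<forall>i. isoparametric_foliation X A g (\<F> i)) \<and>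
     (\<forall>i. \<forall>L\<in>\<F> i. \<forall>L'\<in>\<F> i. diffeomorphic_submanifolds X A L L') \<and>
     (\<forall>i j. i \<noteq> j \<longrightarrow> (\<forall>L\<in>\<F> i. \<forall>L'\<in>\<F> j.
        \<not> (subtopology X L homeomorphic_space subtopology X L')))"
proof -
  obtain S :: "'n set" where S: "card S = 4"
    using obtain_subset_with_card_n[OF assms] by blast
  then obtain xs where xs: "set xs = S" "distinct xs"
    using finite_distinct_list[of S] by auto
  then have "length xs = 4" using S distinct_card by fastforce
  then obtain x y z t where "xs = [x, y, z, t]"
    by (auto simp: numeral_eq_Suc length_Suc_conv)
  then interpret heisenberg x y z t using xs(2) by unfold_locales simp
  show ?thesis
  proof (intro exI conjI allI impI ballI)
    show "closed_riemannian_manifold X A g" by (rule closed_riemannian_manifold_X)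
    \<comment> \<open>The index \<open>Suc i\<close> supplies the positive \<open>k\<close> required
      for moving leaves along the flow and for telling them apart.\<close>
    show "isoparametric_foliation X A g (range (leaf (Suc i)))" for i
      unfolding isoparametric_foliation_def using isoparametric_F level_components_F by metis
    show "diffeomorphic_submanifolds X A L L'"
      if "L \<in> range (leaf (Suc i))" "L' \<in> range (leaf (Suc i))" for i L L'
      using that diffeomorphic_leaves[of "Suc i"] by auto
    show "\<not> subtopology X L homeomorphic_space subtopology X L'"
      if "i \<noteq> j" "L \<in> range (leaf (Suc i))" "L' \<in> range (leaf (Suc j))" for i j L L'
      using that homeomorphic_leaves_imp_eq[of "Suc i" _ "Suc j"] by auto
  qed
qed

end
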